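(* The Banach spaces $Ces_\infty = Ces_\infty[0,\infty)$ and $ces_\infty$ are isomorphic.
   Context: $Ces_\infty[0,\infty)$ is the space of (classes of) Lebesgue measurable functions $f$ on $[0,\infty)$ with $\|f\|=\sup_{x>0}\frac1x\int_0^x|f(t)|\,dt<\infty$. $ces_\infty$ is the space of real sequences $a=(a_n)_{n\ge1}$ with $\|a\|=\sup_{n\ge1}\frac1n\sum_{k=1}^n|a_k|<\infty$. "Isomorphic" means linearly isomorphic as Banach spaces (a bounded linear bijection with bounded inverse). *)

theory Defs
  imports "HOL-Analysis.Analysis"
begin

definition Ces_int :: "(real \<Rightarrow> real) \<Rightarrow> real \<Rightarrow> ennreal" where
  "Ces_int f x = (\<integral>\<^sup>+ t. ennreal (indicator {0..x} t * \<bar>f t\<bar>) \<partial>lebesgue)"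

text \<open>The space Ces_infinity[0,infinity): Lebesgue measurable functions on [0,infinity)
  (values on negative reals are irrelevant) with sup_{x>0} (1/x) int_0^x |f| finite.\<close>
definition Ces_inf :: "(real \<Rightarrow> real) set" where
  "Ces_inf = {f. set_borel_measurable lebesgue {0..} f \<and>
               (\<exists>C::real. \<forall>x>0. Ces_int f x \<le> ennreal (C * x))}"

definition Ces_norm :: "(real \<Rightarrow> real) \<Rightarrow> real" where
  "Ces_norm f = (SUP x\<in>{0<..}. enn2real (Ces_int f x) / x)"

text \<open>The sequence space ces_infinity; a sequence (a_1, a_2, ...) is represented by
  a :: nat => real with a k = a_{k+1}.\<close>
definition ces_inf :: "(nat \<Rightarrow> real) set" where
  "ces_inf = {a. \<exists>C::real. \<forall>n\<ge>1. (\<Sum>k<n. \<bar>a k\<bar>) \<le> C * real n}"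

definition ces_norm :: "(nat \<Rightarrow> real) \<Rightarrow> real" where
  "ces_norm a = (SUP n\<in>{1..}. (\<Sum>k<n. \<bar>a k\<bar>) / real n)"

definition Ces_eq :: "(real \<Rightarrow> real) \<Rightarrow> (real \<Rightarrow> real) \<Rightarrow> bool" where
  "Ces_eq f g \<longleftrightarrow> (AE t in lebesgue. t \<ge> 0 \<longrightarrow> f t = g t)"

end

(*
  Cutting [0,infinity) into the intervals [2^k, 2^(k+1)) with k an integer and rescaling each of them
  identifies Ces_infinity with X = l_infinity(L^1[0,1)), while cutting a sequence into the blocks
  2^n <= k < 2^(n+1) identifies Y = ces_infinity with the l_infinity-sum of the spaces l_1^(2^n).
  By Pelczynski's decomposition method it suffices to complement X and Y in each other.

  Y embeds into X by step functions, with dyadic averages as left inverse. Conversely X embeds into Y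
  by the dyadic averages, in which every coordinate f of X is averaged at infinitely many levels. A left
  inverse is built from a projection of l_infinity(L^1) onto L^1: take a limit, along a filter under
  which all bounded sequences converge, of the integrals over each dyadic interval. The result is
  an L^1-bounded dyadic martingale; its limit in measure (the density of the absolutely continuous
  part of the limit) depends linearly on the sequence and reproduces f from its averages.
*)

theory Submission
  imports Defs "HOL-Library.Function_Algebras" "HOL-Library.Nat_Bijection" "HOL-Library.Discrete_Functions"
begin

section \<open>Bounded operators between seminormed spaces\<close>

text \<open>The obstacle is that limits of a bounded sequence in L^1 are measures in general, so the
  limiting martingale need not come from a function. Its limit in measure discards the singular
  part. Since a limit in measure is unique almost everywhere, the resulting operator is linear, even
  though the existence proof splits functions into positive and negative parts, which is not a
  linear operation.

  A single block of \<open>ces_inf\<close> sees a function only at resolution 2^-n. No block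
  determines the function, hence the repetition of every coordinate at infinitely many levels: the
  averages over a fixed dyadic interval are then constant from some level on, and every limit
  reproduces them.

  All constants 2 in the Cesaro estimates have one origin: a dyadic block has at least half the
  length of the initial segment that ends with it.

  Functions are never replaced by classes. Estimates are carried by upper bounds instead of norms,
  and equality almost everywhere appears as distance 0, so arbitrary choices of representatives are
  harmless.\<close>

instantiation "fun" :: (type, real_vector) real_vector
begin

definition scaleR_fun :: "real \<Rightarrow> ('a \<Rightarrow> 'b) \<Rightarrow> 'a \<Rightarrow> 'b" where
  "scaleR_fun r f = (\<lambda>x. r *\<^sub>R f x)"

instance
  by standard (simp_all add: scaleR_fun_def fun_eq_iff scaleR_add_right scaleR_add_left)

end

lemma scaleR_fun_apply [simp]: "(r *\<^sub>R f) x = r *\<^sub>R f x"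
  by (simp add: scaleR_fun_def)

text \<open>A (semi)normed space is encoded by the relation \<open>B x c\<close>, read as ``\<open>x\<close> belongs to the space and
  \<open>\<parallel>x\<parallel> \<le> c\<close>''. Vectors at distance \<open>0\<close> are identified through \<open>eqv\<close>, so operators are only required
  to be linear up to \<open>eqv\<close>; this covers equality almost everywhere.\<close>

definition norm_gauge :: "('a::real_vector \<Rightarrow> real \<Rightarrow> bool) \<Rightarrow> bool" where
  "norm_gauge B \<longleftrightarrow> B 0 0 \<and> (\<forall>x c. B x c \<longrightarrow> 0 \<le> c) \<and> (\<forall>x c d. B x c \<longrightarrow> c \<le> d \<longrightarrow> B x d) \<and>
     (\<forall>r x y c d. B x c \<longrightarrow> B y d \<longrightarrow> B (r *\<^sub>R x + y) (\<bar>r\<bar> * c + d))"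

definition mem :: "('a \<Rightarrow> real \<Rightarrow> bool) \<Rightarrow> 'a \<Rightarrow> bool" where
  "mem B x \<longleftrightarrow> (\<exists>c. B x c)"

definition eqv :: "('a::real_vector \<Rightarrow> real \<Rightarrow> bool) \<Rightarrow> 'a \<Rightarrow> 'a \<Rightarrow> bool" where
  "eqv B x y \<longleftrightarrow> B (x - y) 0"

definition blin ::
  "('a::real_vector \<Rightarrow> real \<Rightarrow> bool) \<Rightarrow> ('b::real_vector \<Rightarrow> real \<Rightarrow> bool) \<Rightarrow> ('a \<Rightarrow> 'b) \<Rightarrow> bool" where
  "blin B B' T \<longleftrightarrow> (\<exists>K\<ge>0. \<forall>x c. B x c \<longrightarrow> B' (T x) (K * c)) \<and>
     (\<forall>r x y. mem B x \<longrightarrow> mem B y \<longrightarrow> eqv B' (T (r *\<^sub>R x + y)) (r *\<^sub>R T x + T y))"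

text \<open>\<open>B\<close> is, up to isomorphism, a complemented subspace of \<open>B'\<close>:
  \<open>T\<close> embeds it, and \<open>T\<close> after \<open>S\<close> is the projection onto the
  copy.\<close>

definition retract ::
  "('a::real_vector \<Rightarrow> real \<Rightarrow> bool) \<Rightarrow> ('b::real_vector \<Rightarrow> real \<Rightarrow> bool) \<Rightarrow> bool" where
  "retract B B' \<longleftrightarrow> (\<exists>T S. blin B B' T \<and> blin B' B S \<and> (\<forall>x. mem B x \<longrightarrow> eqv B (S (T x)) x))"

definition isomorphic ::
  "('a::real_vector \<Rightarrow> real \<Rightarrow> bool) \<Rightarrow> ('b::real_vector \<Rightarrow> real \<Rightarrow> bool) \<Rightarrow> bool" where
  "isomorphic B B' \<longleftrightarrow> (\<exists>T S. blin B B' T \<and> blin B' B S \<and>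
     (\<forall>x. mem B x \<longrightarrow> eqv B (S (T x)) x) \<and> (\<forall>y. mem B' y \<longrightarrow> eqv B' (T (S y)) y))"

text \<open>The maximum norm on the product. With bounds in place of norms, no supremum has to be
  formed.\<close>

definition prod_gauge ::
  "('a \<Rightarrow> real \<Rightarrow> bool) \<Rightarrow> ('b \<Rightarrow> real \<Rightarrow> bool) \<Rightarrow> 'a \<times> 'b \<Rightarrow> real \<Rightarrow> bool" where
  "prod_gauge B B' p c \<longleftrightarrow> B (fst p) c \<and> B' (snd p) c"

text \<open>The l_infinity-sum of countably many copies of \<open>B\<close>: one bound serves all
  terms.\<close>

definition seq_gauge :: "('a \<Rightarrow> real \<Rightarrow> bool) \<Rightarrow> (nat \<Rightarrow> 'a) \<Rightarrow> real \<Rightarrow> bool" where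
  "seq_gauge B x c \<longleftrightarrow> (\<forall>n. B (x n) c)"

context
  fixes B :: "'a::real_vector \<Rightarrow> real \<Rightarrow> bool"
  assumes B: "norm_gauge B"
begin

lemma gauge_zero: "B 0 0"
  and gauge_nonneg: "B x c \<Longrightarrow> 0 \<le> c"
  and gauge_mono: "B x c \<Longrightarrow> c \<le> d \<Longrightarrow> B x d"
  and gauge_combination: "B x c \<Longrightarrow> B y d \<Longrightarrow> B (r *\<^sub>R x + y) (\<bar>r\<bar> * c + d)"
  using B by (auto simp: norm_gauge_def)

lemma gauge_add: "B x c \<Longrightarrow> B y d \<Longrightarrow> B (x + y) (c + d)"
  using gauge_combination[of x c y d 1] by simp

lemma gauge_diff: "B x c \<Longrightarrow> B y d \<Longrightarrow> B (x - y) (c + d)"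
  using gauge_combination[of y d x c "-1"] by (simp add: add.commute)

lemma mem_add: "mem B x \<Longrightarrow> mem B y \<Longrightarrow> mem B (x + y)"
  and mem_diff: "mem B x \<Longrightarrow> mem B y \<Longrightarrow> mem B (x - y)"
  and mem_combination: "mem B x \<Longrightarrow> mem B y \<Longrightarrow> mem B (r *\<^sub>R x + y)"
  using gauge_add gauge_diff gauge_combination unfolding mem_def by blast+

lemma eqv_refl: "eqv B x x"
  by (simp add: eqv_def gauge_zero)

lemma eqv_sym: "eqv B x y \<Longrightarrow> eqv B y x"
  using gauge_diff[of 0 0 "x - y" 0] gauge_zero by (simp add: eqv_def)

lemma eqv_trans: "eqv B x y \<Longrightarrow> eqv B y z \<Longrightarrow> eqv B x z"
  using gauge_add[of "x - y" 0 "y - z" 0] by (simp add: eqv_def)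

lemma eqv_add: "eqv B x x' \<Longrightarrow> eqv B y y' \<Longrightarrow> eqv B (x + y) (x' + y')"
  using gauge_add[of "x - x'" 0 "y - y'" 0] by (simp add: eqv_def algebra_simps)

lemma eqv_diff: "eqv B x x' \<Longrightarrow> eqv B y y' \<Longrightarrow> eqv B (x - y) (x' - y')"
  using gauge_diff[of "x - x'" 0 "y - y'" 0] by (simp add: eqv_def algebra_simps)

lemma eqv_mem: "eqv B x y \<Longrightarrow> mem B y \<Longrightarrow> mem B x"
  using mem_add[of "x - y" y] by (auto simp: eqv_def mem_def)

end

lemma blin_boundE:
  assumes "blin B B' T"
  obtains K where "K \<ge> 0" "\<And>x c. B x c \<Longrightarrow> B' (T x) (K * c)"
  using assms by (auto simp: blin_def)

lemma blin_combination:
  "blin B B' T \<Longrightarrow> mem B x \<Longrightarrow> mem B y \<Longrightarrow> eqv B' (T (r *\<^sub>R x + y)) (r *\<^sub>R T x + T y)"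
  by (auto simp: blin_def)

lemma blin_mem: "blin B B' T \<Longrightarrow> mem B x \<Longrightarrow> mem B' (T x)"
  unfolding blin_def mem_def by blast

lemma blin_add: "blin B B' T \<Longrightarrow> mem B x \<Longrightarrow> mem B y \<Longrightarrow> eqv B' (T (x + y)) (T x + T y)"
  using blin_combination[of B B' T x y 1] by simp

lemma blin_diff: "blin B B' T \<Longrightarrow> mem B x \<Longrightarrow> mem B y \<Longrightarrow> eqv B' (T (x - y)) (T x - T y)"
  using blin_combination[of B B' T y x "-1"] by simp

text \<open>\<open>blin\<close> does not ask that equivalent vectors have equivalent images. This
  follows from the bound: \<open>y - x\<close> has gauge 0, hence so has its image, and
  \<open>T y\<close> is equivalent to \<open>T (y - x) + T x\<close>.\<close>

lemma blin_cong:
  assumes B: "norm_gauge B" "norm_gauge B'" and T: "blin B B' T" and "mem B x" "eqv B y x"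
  shows "eqv B' (T y) (T x)"
proof -
  have d: "mem B (y - x)" "B (y - x) 0"
    using assms by (auto simp: eqv_def mem_def)
  have "B' (T (y - x)) 0"
    using d by (rule_tac blin_boundE[OF T]) force
  moreover have "eqv B' (T y) (T (y - x) + T x)"
    using blin_add[OF T d(1) \<open>mem B x\<close>] by simp
  ultimately have "B' (T y - (T (y - x) + T x) + T (y - x)) 0"
    using gauge_add[OF B(2)] by (fastforce simp: eqv_def)
  then show ?thesis
    by (simp add: eqv_def algebra_simps)
qed

lemma blinI:
  assumes "K \<ge> 0" "\<And>x c. B x c \<Longrightarrow> B' (T x) (K * c)"
    and "\<And>r x y. mem B x \<Longrightarrow> mem B y \<Longrightarrow> eqv B' (T (r *\<^sub>R x + y)) (r *\<^sub>R T x + T y)"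
  shows "blin B B' T"
  using assms unfolding blin_def by blast

lemma blin_id: "norm_gauge B \<Longrightarrow> blin B B (\<lambda>x. x)"
  by (rule blinI[of 1]) (auto intro: eqv_refl)

lemma blin_compose:
  assumes B: "norm_gauge B'" "norm_gauge B''" and S: "blin B' B'' S" and T: "blin B B' T"
  shows "blin B B'' (\<lambda>x. S (T x))"
proof -
  obtain K L where K: "K \<ge> 0" "\<And>x c. B x c \<Longrightarrow> B' (T x) (K * c)"
    and L: "L \<ge> 0" "\<And>x c. B' x c \<Longrightarrow> B'' (S x) (L * c)"
    using blin_boundE[OF S] blin_boundE[OF T] by metis
  show ?thesis
  proof (rule blinI[of "L * K"])
    fix r x y assume xy: "mem B x" "mem B y"
    then have "mem B' (T x)" "mem B' (T y)"
      using T by (auto intro: blin_mem)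
    then show "eqv B'' (S (T (r *\<^sub>R x + y))) (r *\<^sub>R S (T x) + S (T y))"
      using blin_cong[OF B S mem_combination[OF B(1)] blin_combination[OF T xy]]
        blin_combination[OF S] eqv_trans[OF B(2)] by blast
  qed (use K L in \<open>auto simp: mult.assoc\<close>)
qed

lemma blin_plus:
  assumes B: "norm_gauge B'" and S: "blin B B' S" and T: "blin B B' T"
  shows "blin B B' (\<lambda>x. S x + T x)"
proof -
  obtain K L where K: "K \<ge> 0" "\<And>x c. B x c \<Longrightarrow> B' (T x) (K * c)"
    and L: "L \<ge> 0" "\<And>x c. B x c \<Longrightarrow> B' (S x) (L * c)"
    using blin_boundE[OF S] blin_boundE[OF T] by metis
  show ?thesis
  proof (rule blinI[of "L + K"])
    fix r x y assume "mem B x" "mem B y"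
    then show "eqv B' (S (r *\<^sub>R x + y) + T (r *\<^sub>R x + y)) (r *\<^sub>R (S x + T x) + (S y + T y))"
      using eqv_add[OF B blin_combination[OF S] blin_combination[OF T], of x y x y r r]
      by (simp add: algebra_simps)
  qed (use K L gauge_add[OF B] in \<open>auto simp: distrib_right\<close>)
qed

lemma blin_minus:
  assumes B: "norm_gauge B'" and S: "blin B B' S" and T: "blin B B' T"
  shows "blin B B' (\<lambda>x. S x - T x)"
proof -
  obtain K L where K: "K \<ge> 0" "\<And>x c. B x c \<Longrightarrow> B' (T x) (K * c)"
    and L: "L \<ge> 0" "\<And>x c. B x c \<Longrightarrow> B' (S x) (L * c)"
    using blin_boundE[OF S] blin_boundE[OF T] by metis
  show ?thesis
  proof (rule blinI[of "L + K"])
    fix r x y assume "mem B x" "mem B y"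
    then show "eqv B' (S (r *\<^sub>R x + y) - T (r *\<^sub>R x + y)) (r *\<^sub>R (S x - T x) + (S y - T y))"
      using eqv_diff[OF B blin_combination[OF S] blin_combination[OF T], of x y x y r r]
      by (simp add: algebra_simps)
  qed (use K L gauge_diff[OF B] in \<open>auto simp: distrib_right\<close>)
qed

lemma gauge_prod: "norm_gauge B \<Longrightarrow> norm_gauge B' \<Longrightarrow> norm_gauge (prod_gauge B B')"
  unfolding norm_gauge_def prod_gauge_def zero_prod_def fst_conv snd_conv fst_add snd_add
    fst_scaleR snd_scaleR by blast

lemma eqv_prod_iff: "eqv (prod_gauge B B') p q \<longleftrightarrow> eqv B (fst p) (fst q) \<and> eqv B' (snd p) (snd q)"
  by (simp add: eqv_def prod_gauge_def)

lemma mem_prod_iff: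
  assumes "norm_gauge B" "norm_gauge B'"
  shows "mem (prod_gauge B B') p \<longleftrightarrow> mem B (fst p) \<and> mem B' (snd p)"
proof
  assume "mem B (fst p) \<and> mem B' (snd p)"
  then obtain c d where "B (fst p) c" "B' (snd p) d"
    by (auto simp: mem_def)
  then show "mem (prod_gauge B B') p"
    using gauge_mono[OF assms(1), of _ c "max c d"] gauge_mono[OF assms(2), of _ d "max c d"]
    by (auto simp: mem_def prod_gauge_def)
qed (auto simp: mem_def prod_gauge_def)

lemma blin_fst: "norm_gauge B \<Longrightarrow> norm_gauge B' \<Longrightarrow> blin (prod_gauge B B') B fst"
  by (rule blinI[of 1]) (auto simp: prod_gauge_def intro: eqv_refl)

lemma blin_snd: "norm_gauge B \<Longrightarrow> norm_gauge B' \<Longrightarrow> blin (prod_gauge B B') B' snd"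
  by (rule blinI[of 1]) (auto simp: prod_gauge_def intro: eqv_refl)

lemma blin_Pair:
  assumes B: "norm_gauge B" "norm_gauge B'" "norm_gauge B''" and S: "blin B B' S" and T: "blin B B'' T"
  shows "blin B (prod_gauge B' B'') (\<lambda>x. (S x, T x))"
proof -
  obtain K L where K: "K \<ge> 0" "\<And>x c. B x c \<Longrightarrow> B'' (T x) (K * c)"
    and L: "L \<ge> 0" "\<And>x c. B x c \<Longrightarrow> B' (S x) (L * c)"
    using blin_boundE[OF S] blin_boundE[OF T] by metis
  show ?thesis
  proof (rule blinI[of "max K L"])
    fix x c assume x: "B x c"
    then have "K * c \<le> max K L * c" "L * c \<le> max K L * c"
      using gauge_nonneg[OF B(1) x] by (auto intro: mult_right_mono)
    then show "prod_gauge B' B'' (S x, T x) (max K L * c)"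
      using K(2)[OF x] L(2)[OF x] gauge_mono[OF B(2)] gauge_mono[OF B(3)]
      by (auto simp: prod_gauge_def)
  qed (use K blin_combination[OF S] blin_combination[OF T] in \<open>auto simp: eqv_prod_iff\<close>)
qed

lemma gauge_seq: "norm_gauge B \<Longrightarrow> norm_gauge (seq_gauge B)"
  unfolding norm_gauge_def seq_gauge_def zero_fun_apply plus_fun_apply scaleR_fun_apply by blast

lemma eqv_seq_iff: "eqv (seq_gauge B) x y \<longleftrightarrow> (\<forall>n. eqv B (x n) (y n))"
  by (simp add: eqv_def seq_gauge_def)

lemma mem_seqD: "mem (seq_gauge B) x \<Longrightarrow> mem B (x n)"
  by (auto simp: mem_def seq_gauge_def)

lemma blin_seq_map:
  assumes "blin B B' T"
  shows "blin (seq_gauge B) (seq_gauge B') (\<lambda>x n. T (x n))"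
proof -
  obtain K where K: "K \<ge> 0" "\<And>x c. B x c \<Longrightarrow> B' (T x) (K * c)"
    using blin_boundE[OF assms] by blast
  show ?thesis
  proof (rule blinI[of K])
    fix r x y assume "mem (seq_gauge B) x" "mem (seq_gauge B) y"
    then show "eqv (seq_gauge B') (\<lambda>n. T ((r *\<^sub>R x + y) n)) (r *\<^sub>R (\<lambda>n. T (x n)) + (\<lambda>n. T (y n)))"
      using blin_combination[OF assms] mem_seqD by (fastforce simp: eqv_seq_iff)
  qed (use K in \<open>auto simp: seq_gauge_def\<close>)
qed

lemma blin_seq_reindex: "norm_gauge B \<Longrightarrow> blin (seq_gauge B) (seq_gauge B) (\<lambda>x n. x (\<phi> n))"
  by (rule blinI[of 1]) (auto simp: seq_gauge_def eqv_seq_iff intro: eqv_refl)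

lemma blin_seq_nth: "norm_gauge B \<Longrightarrow> blin (seq_gauge B) B (\<lambda>x. x n)"
  by (rule blinI[of 1]) (auto simp: seq_gauge_def intro: eqv_refl)

lemma isomorphic_sym: "isomorphic B B' \<Longrightarrow> isomorphic B' B"
  unfolding isomorphic_def by blast

lemma isomorphic_imp_retract: "isomorphic B B' \<Longrightarrow> retract B B'"
  unfolding isomorphic_def retract_def by blast

lemma eqv_compose_inverse:
  assumes "norm_gauge B" "norm_gauge B'" "blin B B' T" "blin B' B S" "blin B' B'' T'" "blin B'' B' S'"
    and "\<And>x. mem B x \<Longrightarrow> eqv B (S (T x)) x" "\<And>y. mem B' y \<Longrightarrow> eqv B' (S' (T' y)) y" "mem B x"
  shows "eqv B (S (S' (T' (T x)))) x"
proof -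
  have "mem B' (T x)"
    using assms blin_mem by blast
  then have "eqv B (S (S' (T' (T x)))) (S (T x))"
    using assms by (intro blin_cong[of B' B S]) auto
  then show ?thesis
    using assms eqv_trans by blast
qed

lemma retract_trans:
  assumes B: "norm_gauge B" "norm_gauge B'" "norm_gauge B''" and "retract B B'" "retract B' B''"
  shows "retract B B''"
proof -
  obtain T S T' S' where h: "blin B B' T" "blin B' B S" "blin B' B'' T'" "blin B'' B' S'"
    "\<And>x. mem B x \<Longrightarrow> eqv B (S (T x)) x" "\<And>y. mem B' y \<Longrightarrow> eqv B' (S' (T' y)) y"
    using assms(4,5) unfolding retract_def by blast
  show ?thesis
    unfolding retract_def
  proof (intro exI conjI allI impI)
    show "blin B B'' (\<lambda>x. T' (T x))" "blin B'' B (\<lambda>x. S (S' x))"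
      using blin_compose[OF B(2,3) h(3,1)] blin_compose[OF B(2,1) h(2,4)] .
  next
    fix x assume "mem B x"
    then show "eqv B (S (S' (T' (T x)))) x"
      using eqv_compose_inverse[of B B' T S B'' T' S' x] B h by blast
  qed
qed

lemma isomorphic_trans:
  assumes B: "norm_gauge B" "norm_gauge B'" "norm_gauge B''" and "isomorphic B B'" "isomorphic B' B''"
  shows "isomorphic B B''"
proof -
  obtain T S T' S' where h: "blin B B' T" "blin B' B S" "blin B' B'' T'" "blin B'' B' S'"
    "\<And>x. mem B x \<Longrightarrow> eqv B (S (T x)) x" "\<And>y. mem B' y \<Longrightarrow> eqv B' (S' (T' y)) y"
    "\<And>y. mem B' y \<Longrightarrow> eqv B' (T (S y)) y" "\<And>y. mem B'' y \<Longrightarrow> eqv B'' (T' (S' y)) y"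
    using assms(4,5) unfolding isomorphic_def by metis
  show ?thesis
    unfolding isomorphic_def
  proof (intro exI conjI allI impI)
    show "blin B B'' (\<lambda>x. T' (T x))" "blin B'' B (\<lambda>x. S (S' x))"
      using blin_compose[OF B(2,3) h(3,1)] blin_compose[OF B(2,1) h(2,4)] .
  next
    fix x assume "mem B x"
    then show "eqv B (S (S' (T' (T x)))) x"
      using eqv_compose_inverse[of B B' T S B'' T' S' x] B h by blast
  next
    fix y assume "mem B'' y"
    then show "eqv B'' (T' (T (S (S' y)))) y"
      using eqv_compose_inverse[of B'' B' S' T' B S T y] B h by blast
  qed
qed

lemma isomorphic_prod_swap:
  assumes B: "norm_gauge B" "norm_gauge B'"
  shows "isomorphic (prod_gauge B B') (prod_gauge B' B)"
  unfolding isomorphic_def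
proof (intro exI conjI allI impI)
  show "blin (prod_gauge B B') (prod_gauge B' B) (\<lambda>p. (snd p, fst p))"
    by (rule blin_Pair[OF gauge_prod[OF B] B(2,1) blin_snd[OF B] blin_fst[OF B]])
  show "blin (prod_gauge B' B) (prod_gauge B B') (\<lambda>p. (snd p, fst p))"
    by (rule blin_Pair[OF gauge_prod[OF B(2,1)] B blin_snd[OF B(2,1)] blin_fst[OF B(2,1)]])
qed (simp_all add: eqv_refl gauge_prod B)

lemma isomorphic_seq_square:
  assumes B: "norm_gauge B"
  shows "isomorphic (seq_gauge B) (prod_gauge (seq_gauge B) (seq_gauge B))"
  unfolding isomorphic_def
proof (intro exI conjI allI impI)
  show "blin (seq_gauge B) (prod_gauge (seq_gauge B) (seq_gauge B)) (\<lambda>x. (\<lambda>n. x (2 * n), \<lambda>n. x (2 * n + 1)))"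
    using B by (intro blin_Pair gauge_seq blin_seq_reindex)
  show "blin (prod_gauge (seq_gauge B) (seq_gauge B)) (seq_gauge B)
          (\<lambda>p n. if even n then fst p (n div 2) else snd p (n div 2))"
    using B by (intro blinI[of 1]) (auto simp: seq_gauge_def prod_gauge_def eqv_seq_iff eqv_refl)
qed (use B in \<open>auto simp: eqv_seq_iff eqv_prod_iff intro: eqv_refl\<close>)

lemma isomorphic_seq_seq:
  assumes B: "norm_gauge B"
  shows "isomorphic (seq_gauge B) (seq_gauge (seq_gauge B))"
  unfolding isomorphic_def
proof (intro exI conjI allI impI)
  show "blin (seq_gauge B) (seq_gauge (seq_gauge B)) (\<lambda>x m n. x (prod_encode (m, n)))"
    using B by (intro blinI[of 1]) (auto simp: seq_gauge_def eqv_seq_iff eqv_refl)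
  show "blin (seq_gauge (seq_gauge B)) (seq_gauge B)
      (\<lambda>x n. x (fst (prod_decode n)) (snd (prod_decode n)))"
    using B by (intro blinI[of 1]) (auto simp: seq_gauge_def eqv_seq_iff eqv_refl)
qed (use B in \<open>auto simp: eqv_seq_iff intro: eqv_refl\<close>)

section \<open>Pelczynski's decomposition method\<close>

text \<open>Since \<open>Q\<close> is a left inverse of \<open>A\<close>, the vector
  \<open>y - A (Q y)\<close> is the component of \<open>y\<close> in the kernel of \<open>Q\<close>.
  Adding \<open>A u\<close> thus exchanges the \<open>B\<close>-component of \<open>y\<close> for
  \<open>u\<close>.\<close>

lemma retract_split:
  assumes G: "norm_gauge B" "norm_gauge B'" and A: "blin B B' A" and Q: "blin B' B Q"
    and QA: "\<And>x. mem B x \<Longrightarrow> eqv B (Q (A x)) x" and u: "mem B u" and y: "mem B' y"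
  shows "eqv B (Q (A u + (y - A (Q y)))) u"
proof -
  have m: "mem B' (A u)" "mem B (Q y)" "mem B' (A (Q y))" "mem B' (y - A (Q y))"
    using u y by (simp_all add: blin_mem[OF A] blin_mem[OF Q] mem_diff[OF G(2)])
  have "eqv B (Q (y - A (Q y))) (Q y - Q y)"
    using blin_diff[OF Q y m(3)] eqv_diff[OF G(1) eqv_refl[OF G(1)] QA[OF m(2)]]
      eqv_trans[OF G(1)] by blast
  then have "eqv B (Q (A u) + Q (y - A (Q y))) (u + (Q y - Q y))"
    using QA[OF u] by (intro eqv_add[OF G(1)])
  then show ?thesis
    using blin_add[OF Q m(1) m(4)] eqv_trans[OF G(1)] by auto
qed

lemma isomorphic_absorb_retract:
  assumes G: "norm_gauge B" "norm_gauge B'" and "retract B B'" "isomorphic B (prod_gauge B B)"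
  shows "isomorphic (prod_gauge B B') B'"
proof -
  obtain A Q where A: "blin B B' A" and Q: "blin B' B Q"
    and QA: "\<And>x. mem B x \<Longrightarrow> eqv B (Q (A x)) x"
    using assms(3) unfolding retract_def by blast
  obtain T S where T: "blin B (prod_gauge B B) T" and S: "blin (prod_gauge B B) B S"
    and ST: "\<And>x. mem B x \<Longrightarrow> eqv B (S (T x)) x"
    and TS: "\<And>p. mem (prod_gauge B B) p \<Longrightarrow> eqv (prod_gauge B B) (T (S p)) p"
    using assms(4) unfolding isomorphic_def by blast
  note gs = G gauge_prod[OF G] gauge_prod[OF G(1) G(1)]
  note intros = blin_plus blin_minus blin_compose[OF gs(1,2) A] blin_compose[OF gs(2,1) Q]
    blin_compose[OF gs(1,4) T] blin_compose[OF gs(4,1) S] blin_Pair blin_fst blin_snd blin_id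
    blin_compose[OF gs(4,1) blin_fst] blin_compose[OF gs(4,1) blin_snd] gs
  txt \<open>These are the composed isomorphisms \<open>B' = B + ker Q = B + B + ker Q = B + B'\<close>.\<close>
  define V where "V = (\<lambda>p. A (S (fst p, Q (snd p))) + (snd p - A (Q (snd p))))"
  define W where "W = (\<lambda>y. (fst (T (Q y)), A (snd (T (Q y))) + (y - A (Q y))))"
  have V: "blin (prod_gauge B B') B' V"
    unfolding V_def by (intro intros)
  have W: "blin B' (prod_gauge B B') W"
    unfolding W_def by (intro intros)
  have split: "eqv B (Q (A u + (y - A (Q y)))) u" if "mem B u" "mem B' y" for u y
    using that by (intro retract_split[OF G A Q QA])
  show ?thesis
    unfolding isomorphic_def
  proof (intro exI conjI allI impI)
    fix p assume "mem (prod_gauge B B') p"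
    then have p: "mem B (fst p)" "mem B' (snd p)" "mem B (Q (snd p))"
      using blin_mem[OF Q] by (auto simp: mem_prod_iff[OF G])
    then have u: "mem (prod_gauge B B) (fst p, Q (snd p))"
      by (simp add: mem_prod_iff[OF G(1) G(1)])
    note s = blin_mem[OF S u]
    \<comment> \<open>By \<open>split\<close>, \<open>Q (V p)\<close> is equivalent to
      \<open>S (fst p, Q (snd p))\<close>, from which \<open>T\<close> recovers both
      entries.\<close>
    have "eqv (prod_gauge B B) (T (Q (V p))) (fst p, Q (snd p))"
      using blin_cong[OF gs(1,4) T s split[OF s p(2)]] TS[OF u] eqv_trans[OF gs(4)]
      unfolding V_def by blast
    then have TQ: "eqv B (fst (T (Q (V p)))) (fst p)" "eqv B (snd (T (Q (V p)))) (Q (snd p))"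
      by (auto simp: eqv_prod_iff)
    have 1: "eqv B' (A (snd (T (Q (V p))))) (A (Q (snd p)))"
      using blin_cong[OF G A p(3) TQ(2)] .
    have 2: "eqv B' (A (Q (V p))) (A (S (fst p, Q (snd p))))"
      using blin_cong[OF G A s split[OF s p(2)]] unfolding V_def by simp
    have "eqv B' (A (snd (T (Q (V p)))) + (V p - A (Q (V p))))
        (A (Q (snd p)) + (V p - A (S (fst p, Q (snd p)))))"
      by (intro eqv_add[OF G(2)] eqv_diff[OF G(2)] eqv_refl[OF G(2)] 1 2)
    also have "A (Q (snd p)) + (V p - A (S (fst p, Q (snd p)))) = snd p"
      by (simp add: V_def)
    finally show "eqv (prod_gauge B B') (W (V p)) p"
      using TQ by (simp add: W_def eqv_prod_iff)
  next
    fix y assume y: "mem B' y"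
    note q = blin_mem[OF Q y]
    note t = blin_mem[OF T q]
    then have t': "mem B (snd (T (Q y)))" "mem B (fst (T (Q y)))"
      by (auto simp: mem_prod_iff[OF G(1) G(1)])
    have 0: "eqv B (Q (snd (W y))) (snd (T (Q y)))"
      using split[OF t'(1) y] by (simp add: W_def)
    have "eqv B (S (fst (W y), Q (snd (W y)))) (Q y)"
      using blin_cong[OF gs(4,1) S t, of "(fst (W y), Q (snd (W y)))"] 0 ST[OF q]
        eqv_trans[OF G(1)] eqv_refl[OF G(1)]
      by (auto simp: eqv_prod_iff W_def)
    then have 1: "eqv B' (A (S (fst (W y), Q (snd (W y))))) (A (Q y))"
      by (rule blin_cong[OF G A q])
    have 2: "eqv B' (A (Q (snd (W y)))) (A (snd (T (Q y))))"
      by (rule blin_cong[OF G A t'(1) 0])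
    have "eqv B' (V (W y)) (A (Q y) + (snd (W y) - A (snd (T (Q y)))))"
      unfolding V_def by (intro eqv_add[OF G(2)] eqv_diff[OF G(2)] eqv_refl[OF G(2)] 1 2)
    also have "A (Q y) + (snd (W y) - A (snd (T (Q y)))) = y"
      by (simp add: W_def)
    finally show "eqv B' (V (W y)) y" .
  qed (rule V W)+
qed

lemma blin_seq_Cons:
  assumes B: "norm_gauge C" "norm_gauge B" and S: "blin C B S" and T: "blin C (seq_gauge B) T"
  shows "blin C (seq_gauge B) (\<lambda>p n. case n of 0 \<Rightarrow> S p | Suc m \<Rightarrow> T p m)"
proof -
  obtain K where K: "K \<ge> 0" "\<And>x c. C x c \<Longrightarrow> prod_gauge B (seq_gauge B) (S x, T x) (K * c)"
    using blin_boundE[OF blin_Pair[OF B gauge_seq[OF B(2)] S T]] by metis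
  show ?thesis
  proof (rule blinI[of K])
    fix x c assume "C x c"
    then show "seq_gauge B (\<lambda>n. case n of 0 \<Rightarrow> S x | Suc m \<Rightarrow> T x m) (K * c)"
      using K(2)[of x c] by (simp add: prod_gauge_def seq_gauge_def split: nat.split)
  next
    fix r x y assume "mem C x" "mem C y"
    then have "eqv B (S (r *\<^sub>R x + y)) (r *\<^sub>R S x + S y)"
      "eqv (seq_gauge B) (T (r *\<^sub>R x + y)) (r *\<^sub>R T x + T y)"
      using blin_combination S T by blast+
    then show "eqv (seq_gauge B) (\<lambda>n. case n of 0 \<Rightarrow> S (r *\<^sub>R x + y) | Suc m \<Rightarrow> T (r *\<^sub>R x + y) m)
        (r *\<^sub>R (\<lambda>n. case n of 0 \<Rightarrow> S x | Suc m \<Rightarrow> T x m) + (\<lambda>n. case n of 0 \<Rightarrow> S y | Suc m \<Rightarrow> T y m))"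
      by (simp add: eqv_seq_iff split: nat.split)
  qed (rule K)
qed

lemma isomorphic_seq_absorb_retract:
  assumes G: "norm_gauge B" "norm_gauge B'" and "retract B' B"
  shows "isomorphic (seq_gauge B) (prod_gauge B' (seq_gauge B))"
proof -
  obtain A Q where A: "blin B' B A" and Q: "blin B B' Q"
    and QA: "\<And>x. mem B' x \<Longrightarrow> eqv B' (Q (A x)) x"
    using assms(3) unfolding retract_def by blast
  have split: "eqv B' (Q (A u + (y - A (Q y)))) u" if "mem B' u" "mem B y" for u y
    using that by (intro retract_split[OF G(2,1) A Q QA])
  note gs = G gauge_seq[OF G(1)] gauge_prod[OF G(2) gauge_seq[OF G(1)]] gauge_seq[OF G(2)]
  txt \<open>With \<open>B = B' + ker Q\<close>, the \<open>B'\<close>-components of a sequence are shifted by one place and the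
    components in \<open>ker Q\<close> stay.\<close>
  define u where "u = (\<lambda>p n. case n of 0 \<Rightarrow> fst p | Suc m \<Rightarrow> Q (snd p m))"
  define V where "V = (\<lambda>x. (Q (x 0), \<lambda>n::nat. A (Q (x (Suc n))) + (x n - A (Q (x n)))))"
  define W where "W = (\<lambda>p (n::nat). A (u p n) + (snd p n - A (Q (snd p n))))"
  have AQ: "blin (seq_gauge B) (seq_gauge B) (\<lambda>x n. A (Q (x n)))"
    by (rule blin_seq_map[OF blin_compose[OF gs(2,1) A Q]])
  have "blin (seq_gauge B) (seq_gauge B) (\<lambda>x. (\<lambda>n. A (Q (x (Suc n)))) + (x - (\<lambda>n. A (Q (x n)))))"
    using blin_compose[OF gs(3,3) AQ blin_seq_reindex[OF G(1), of Suc]]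
    by (rule blin_plus[OF gs(3) _ blin_minus[OF gs(3) blin_id[OF gs(3)] AQ]])
  then have V: "blin (seq_gauge B) (prod_gauge B' (seq_gauge B)) V"
    unfolding V_def using blin_compose[OF gs(1,2) Q blin_seq_nth[OF G(1)]]
    by (intro blin_Pair gs) (auto simp: plus_fun_def fun_diff_def)
  have u: "blin (prod_gauge B' (seq_gauge B)) (seq_gauge B') u"
    unfolding u_def
    by (rule blin_seq_Cons[OF gs(4,2) blin_fst[OF gs(2,3)]
          blin_compose[OF gs(3,5) blin_seq_map[OF Q] blin_snd[OF gs(2,3)]]])
  have "blin (prod_gauge B' (seq_gauge B)) (seq_gauge B)
      (\<lambda>p. (\<lambda>n. A (u p n)) + (snd p - (\<lambda>n. A (Q (snd p n)))))"
    by (rule blin_plus[OF gs(3) blin_compose[OF gs(5,3) blin_seq_map[OF A] u]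
          blin_minus[OF gs(3) blin_snd[OF gs(2,3)] blin_compose[OF gs(3,3) AQ blin_snd[OF gs(2,3)]]]])
  then have W: "blin (prod_gauge B' (seq_gauge B)) (seq_gauge B) W"
    unfolding W_def by (simp add: plus_fun_def fun_diff_def)
  show ?thesis
    unfolding isomorphic_def
  proof (intro exI conjI allI impI)
    fix x assume "mem (seq_gauge B) x"
    then have x: "mem B (x n)" "mem B' (Q (x n))" for n
      using blin_mem[OF Q] by (auto dest: mem_seqD)
    have v: "eqv B' (Q (snd (V x) n)) (Q (x (Suc n)))" for n
      using split[OF x(2) x(1)] by (simp add: V_def)
    have "eqv B' (u (V x) n) (Q (x n))" for n
      using v eqv_refl[OF G(2)] by (cases n) (auto simp: u_def V_def)
    then have "eqv B (W (V x) n) (A (Q (x n)) + (snd (V x) n - A (Q (x (Suc n)))))" for n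
      unfolding W_def using x v
      by (intro eqv_add[OF G(1)] eqv_diff[OF G(1)] eqv_refl[OF G(1)] blin_cong[OF G(2,1) A])
    moreover have "A (Q (x n)) + (snd (V x) n - A (Q (x (Suc n)))) = x n" for n
      by (simp add: V_def)
    ultimately show "eqv (seq_gauge B) (W (V x)) x"
      by (simp add: eqv_seq_iff)
  next
    fix p assume p: "mem (prod_gauge B' (seq_gauge B)) p"
    then have z: "mem B (snd p n)" "mem B' (u p n)" for n
      using blin_mem[OF u p] by (auto simp: mem_prod_iff[OF gs(2,3)] dest: mem_seqD)
    have w: "eqv B' (Q (W p n)) (u p n)" for n
      using split[OF z(2) z(1)] by (simp add: W_def)
    have "eqv B (snd (V (W p)) n) (A (u p (Suc n)) + (W p n - A (u p n)))" for n
      unfolding V_def snd_conv using z w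
      by (intro eqv_add[OF G(1)] eqv_diff[OF G(1)] eqv_refl[OF G(1)] blin_cong[OF G(2,1) A])
    moreover have "A (u p (Suc n)) + (W p n - A (u p n)) = snd p n" for n
      by (simp add: W_def u_def)
    moreover have "eqv B' (fst (V (W p))) (fst p)"
      using w[of 0] by (simp add: V_def u_def)
    ultimately show "eqv (prod_gauge B' (seq_gauge B)) (V (W p)) p"
      by (simp add: eqv_prod_iff eqv_seq_iff)
  qed (rule V W)+
qed

text \<open>The chain is X = Z = Y + Z = Z + Y = Y with Z = l_infinity(X). The detour through Z is
  needed because \<open>Y\<close> is a retract of X but not visibly of \<open>B\<close>: the shift
  argument absorbs a retract of the coordinate space, so the coordinates have to be copies of
  X.\<close>

theorem pelczynski_decomposition:
  assumes B: "norm_gauge B" and Y: "norm_gauge Y" and "retract (seq_gauge B) Y" "retract Y (seq_gauge B)"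
  shows "isomorphic (seq_gauge B) Y"
proof -
  let ?X = "seq_gauge B" and ?Z = "seq_gauge (seq_gauge B)"
  note gs = gauge_seq[OF B] gauge_seq[OF gauge_seq[OF B]] Y
  note gp = gauge_prod[OF gs(2,3)] gauge_prod[OF gs(3,2)]
  have Z: "isomorphic ?X ?Z"
    by (rule isomorphic_seq_seq[OF B])
  then have "retract ?Z Y"
    using assms(3) gs by (meson isomorphic_imp_retract isomorphic_sym retract_trans)
  then have "isomorphic (prod_gauge ?Z Y) Y"
    by (intro isomorphic_absorb_retract gs isomorphic_seq_square)
  moreover have "isomorphic ?Z (prod_gauge Y ?Z)"
    by (intro isomorphic_seq_absorb_retract gs assms)
  ultimately have "isomorphic ?Z Y"
    using isomorphic_prod_swap[OF gs(3,2)] gs gp by (meson isomorphic_trans)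
  then show ?thesis
    using Z gs isomorphic_trans by blast
qed

section \<open>Dyadic step functions and averages\<close>

abbreviation unit_leb :: "real measure" where
  "unit_leb \<equiv> lebesgue_on {0..<1}"

text \<open>A step function on the dyadic cells of [0,1). There it uses only the values
  \<open>a j\<close> with \<open>j < 2 ^ n\<close>; its values at other points do not affect
  integrals over \<open>unit_leb\<close>.\<close>

definition step :: "nat \<Rightarrow> (nat \<Rightarrow> real) \<Rightarrow> real \<Rightarrow> real" where
  "step n a s = a (nat \<lfloor>2 ^ n * s\<rfloor>)"

definition cell :: "nat \<Rightarrow> nat \<Rightarrow> real set" where
  "cell n j = {real j / 2 ^ n..<(real j + 1) / 2 ^ n}"

text \<open>\<open>step n (avg n f)\<close> is the conditional expectation of \<open>f\<close> on
  the algebra of dyadic cells of level \<open>n\<close>. For \<open>2 ^ n \<le> j\<close> the cell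
  lies outside [0,1) and the average is 0.\<close>

definition avg :: "nat \<Rightarrow> (real \<Rightarrow> real) \<Rightarrow> nat \<Rightarrow> real" where
  "avg n f j = 2 ^ n * (\<integral>s. indicator (cell n j) s * f s \<partial>unit_leb)"

lemma finite_measure_unit_leb: "finite_measure unit_leb"
  by (rule finite_measureI) (simp add: emeasure_restrict_space space_restrict_space)

lemma measure_unit_leb: "measure unit_leb {0..<1} = 1"
  by (simp add: measure_restrict_space)

lemma mem_cell_iff: "0 \<le> s \<Longrightarrow> s \<in> cell n j \<longleftrightarrow> nat \<lfloor>2 ^ n * s\<rfloor> = j"
proof -
  assume "0 \<le> s"
  then have "nat \<lfloor>2 ^ n * s\<rfloor> = j \<longleftrightarrow> \<lfloor>2 ^ n * s\<rfloor> = int j"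
    by (auto simp: nat_eq_iff)
  also have "\<dots> \<longleftrightarrow> real j \<le> 2 ^ n * s \<and> 2 ^ n * s < real j + 1"
    by (simp add: floor_eq_iff)
  also have "\<dots> \<longleftrightarrow> s \<in> cell n j"
    by (simp add: cell_def field_simps)
  finally show ?thesis by simp
qed

lemma index_less: "0 \<le> s \<Longrightarrow> s < 1 \<Longrightarrow> nat \<lfloor>2 ^ n * s\<rfloor> < 2 ^ n"
proof -
  assume "0 \<le> s" "s < 1"
  then have "\<lfloor>2 ^ n * s\<rfloor> < 2 ^ n"
    by (simp add: floor_less_iff)
  then show ?thesis
    by (simp add: nat_less_iff \<open>0 \<le> s\<close>)
qed

lemma cell_subset: "j < 2 ^ n \<Longrightarrow> cell n j \<subseteq> {0..<1}"
proof -
  assume "j < 2 ^ n"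
  then have "real (j + 1) \<le> real (2 ^ n)"
    by (simp only: of_nat_le_iff)
  then have "(real j + 1) / 2 ^ n \<le> 1"
    by (simp add: field_simps)
  then show ?thesis
    by (auto simp: cell_def intro: order_trans less_le_trans)
qed

lemma cell_sets [measurable]: "cell n j \<in> sets lebesgue"
  by (simp add: cell_def)

lemma indicator_cell_measurable [measurable]:
  "(indicator (cell n j) :: real \<Rightarrow> real) \<in> borel_measurable unit_leb"
  by (intro measurable_restrict_space1) auto

lemma measure_cell:
  assumes "j < 2 ^ n"
  shows "measure unit_leb (cell n j) = 1 / 2 ^ n"
proof -
  have "measure unit_leb (cell n j) = measure lebesgue (cell n j)"
    using cell_subset[OF assms] by (simp add: measure_restrict_space)
  also have "\<dots> = 1 / 2 ^ n"
    by (simp add: cell_def field_simps)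
  finally show ?thesis .
qed

lemma step_eq_sum:
  assumes "0 \<le> s" "s < 1"
  shows "step n a s = (\<Sum>j<2 ^ n. indicator (cell n j) s * a j)"
proof -
  have "(\<Sum>j<2 ^ n. indicator (cell n j) s * a j)
      = (\<Sum>j<2 ^ n. if nat \<lfloor>2 ^ n * s\<rfloor> = j then a j else 0)"
    using assms by (intro sum.cong) (auto simp: indicator_def mem_cell_iff)
  also have "\<dots> = step n a s"
    using index_less[OF assms, of n] by (simp add: step_def)
  finally show ?thesis by simp
qed

lemma integrable_indicator_cell:
  fixes f :: "real \<Rightarrow> real"
  assumes "integrable unit_leb f"
  shows "integrable unit_leb (\<lambda>s. indicator (cell n j) s * f s)"
proof (rule Bochner_Integration.integrable_bound[OF assms])
  show "(\<lambda>s. indicator (cell n j) s * f s) \<in> borel_measurable unit_leb"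
    using assms by measurable
qed (simp add: indicator_def)

lemma integrable_const_unit [simp]: "integrable unit_leb (\<lambda>s. c::real)"
  by (rule finite_measure.integrable_const[OF finite_measure_unit_leb])

lemma integral_indicator_cell:
  fixes c :: real
  assumes "j < 2 ^ n"
  shows "(\<integral>s. indicator (cell n j) s * c \<partial>unit_leb) = c / 2 ^ n"
proof -
  have "(\<integral>s. indicator (cell n j) s \<partial>unit_leb) = (1 / 2 ^ n :: real)"
    using cell_subset[OF assms] measure_cell[OF assms]
    by (simp add: Int_absorb2 space_restrict_space)
  then show ?thesis
    by simp
qed

lemma integrable_step: "integrable unit_leb (step n a)"
proof -
  have "integrable unit_leb (\<lambda>s. \<Sum>j<2 ^ n. indicator (cell n j) s * a j)"
    by (intro Bochner_Integration.integrable_sum integrable_indicator_cell integrable_const_unit)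
  then show ?thesis
    by (rule Bochner_Integration.integrable_cong[THEN iffD1, rotated -1])
      (auto simp: space_restrict_space step_eq_sum)
qed

lemma integral_step: "(\<integral>s. step n a s \<partial>unit_leb) = (\<Sum>j<2 ^ n. a j) / 2 ^ n"
proof -
  have "(\<integral>s. step n a s \<partial>unit_leb) = (\<integral>s. (\<Sum>j<2 ^ n. indicator (cell n j) s * a j) \<partial>unit_leb)"
    by (intro Bochner_Integration.integral_cong) (auto simp: space_restrict_space step_eq_sum)
  also have "\<dots> = (\<Sum>j<2 ^ n. \<integral>s. indicator (cell n j) s * a j \<partial>unit_leb)"
    by (intro Bochner_Integration.integral_sum integrable_indicator_cell integrable_const_unit)
  also have "\<dots> = (\<Sum>j<2 ^ n. a j / 2 ^ n)"
    by (intro sum.cong refl integral_indicator_cell) simp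
  finally show ?thesis
    by (simp add: sum_divide_distrib)
qed

lemma step_compose: "f (step n a s) = step n (\<lambda>j. f (a j)) s"
  by (simp add: step_def)

text \<open>The index of a point at level \<open>n\<close> consists of the leading binary digits of
  its index at level \<open>n + k\<close>. So \<open>j div 2 ^ k\<close> stands for the cell of
  level \<open>n\<close> that contains cell \<open>j\<close>.\<close>

lemma index_div: "0 \<le> (s::real) \<Longrightarrow> nat \<lfloor>2 ^ (n + k) * s\<rfloor> div 2 ^ k = nat \<lfloor>2 ^ n * s\<rfloor>"
proof -
  assume s: "0 \<le> s"
  have "\<lfloor>2 ^ n * s\<rfloor> = \<lfloor>(2 ^ (n + k) * s) / real_of_int (2 ^ k)\<rfloor>"
    by (simp add: power_add)
  also have "\<dots> = \<lfloor>2 ^ (n + k) * s\<rfloor> div 2 ^ k"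
    by (rule floor_divide_real_eq_div) simp
  finally show ?thesis
    using s by (simp add: nat_div_distrib nat_power_eq)
qed

lemma sum_even_odd: "(\<Sum>j<2 * N. f j) = (\<Sum>i<N. f (2 * i) + f (2 * i + 1 :: nat))"
  for f :: "nat \<Rightarrow> real"
  by (induction N) (simp_all add: algebra_simps)

lemma cell_Suc:
  "indicator (cell n j) s = (indicator (cell (Suc n) (2 * j)) s + indicator (cell (Suc n) (2 * j + 1)) s :: real)"
proof (cases "0 \<le> s")
  case True
  define i where "i = nat \<lfloor>2 ^ Suc n * s\<rfloor>"
  have "s \<in> cell n j \<longleftrightarrow> i div 2 = j"
    using index_div[OF True, of n 1] True by (simp add: mem_cell_iff i_def)
  moreover have "s \<in> cell (Suc n) k \<longleftrightarrow> i = k" for k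
    using True by (simp only: mem_cell_iff i_def)
  moreover have "i div 2 = j \<longleftrightarrow> i = 2 * j \<or> i = 2 * j + 1"
    by presburger
  ultimately show ?thesis
    by (auto simp: indicator_def)
next
  case False
  moreover have "0 \<le> real i / 2 ^ m" for i m
    by simp
  ultimately have "s \<notin> cell m i" for m i
    unfolding cell_def atLeastLessThan_iff using order_trans by blast
  then show ?thesis by simp
qed

text \<open>The martingale property, as a cell is the disjoint union of its two halves. It holds for
  every \<open>j\<close>, also for cells outside [0,1), which is the form that the martingale limit
  lemma assumes.\<close>

lemma avg_refine:
  assumes "integrable unit_leb f"
  shows "avg n f j = (avg (Suc n) f (2 * j) + avg (Suc n) f (2 * j + 1)) / 2"
proof -
  have "(\<integral>s. indicator (cell n j) s * f s \<partial>unit_leb) =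
      (\<integral>s. indicator (cell (Suc n) (2 * j)) s * f s \<partial>unit_leb) +
      (\<integral>s. indicator (cell (Suc n) (2 * j + 1)) s * f s \<partial>unit_leb)"
    unfolding cell_Suc[of n j] distrib_right
    by (intro Bochner_Integration.integral_add integrable_indicator_cell assms)
  then show ?thesis
    by (simp add: avg_def algebra_simps)
qed

lemma avg_combination:
  assumes "integrable unit_leb f" "integrable unit_leb g"
  shows "avg n (\<lambda>s. r * f s + g s) j = r * avg n f j + avg n g j"
proof -
  have "(\<integral>s. r * (indicator (cell n j) s * f s) + indicator (cell n j) s * g s \<partial>unit_leb) =
      r * (\<integral>s. indicator (cell n j) s * f s \<partial>unit_leb) + (\<integral>s. indicator (cell n j) s * g s \<partial>unit_leb)"
    by (subst Bochner_Integration.integral_add)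
      (auto intro!: integrable_indicator_cell integrable_mult_right assms)
  then show ?thesis
    by (simp add: avg_def algebra_simps)
qed

lemma avg_step:
  assumes "j < 2 ^ n"
  shows "avg n (step n a) j = a j"
proof -
  have "(\<integral>s. indicator (cell n j) s * step n a s \<partial>unit_leb) =
      (\<integral>s. indicator (cell n j) s * a j \<partial>unit_leb)"
    by (intro Bochner_Integration.integral_cong)
      (auto simp: space_restrict_space indicator_def mem_cell_iff step_def)
  then show ?thesis
    by (simp add: avg_def integral_indicator_cell[OF assms] del: integral_mult_left_zero)
qed

lemma abs_avg_le:
  assumes "integrable unit_leb f"
  shows "\<bar>avg n f j\<bar> \<le> avg n (\<lambda>s. \<bar>f s\<bar>) j"
proof -
  have "\<bar>\<integral>s. indicator (cell n j) s * f s \<partial>unit_leb\<bar> \<le> (\<integral>s. \<bar>indicator (cell n j) s * f s\<bar> \<partial>unit_leb)"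
    by (rule integral_abs_bound)
  then show ?thesis
    by (simp add: avg_def abs_mult)
qed

lemma sum_avg:
  assumes "integrable unit_leb f"
  shows "(\<Sum>j<2 ^ n. avg n f j) = 2 ^ n * (\<integral>s. f s \<partial>unit_leb)"
proof -
  have "(\<Sum>j<2 ^ n. \<integral>s. indicator (cell n j) s * f s \<partial>unit_leb) =
      (\<integral>s. (\<Sum>j<2 ^ n. indicator (cell n j) s * f s) \<partial>unit_leb)"
    by (intro Bochner_Integration.integral_sum[symmetric] integrable_indicator_cell assms)
  also have "\<dots> = (\<integral>s. f s \<partial>unit_leb)"
  proof (intro Bochner_Integration.integral_cong refl)
    fix s assume "s \<in> space unit_leb"
    then have "(\<Sum>j<2 ^ n. indicator (cell n j) s) = (1::real)"
      using step_eq_sum[of s n "\<lambda>_. 1"] by (simp add: space_restrict_space step_def)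
    then show "(\<Sum>j<2 ^ n. indicator (cell n j) s * f s) = f s"
      by (simp add: sum_distrib_right[symmetric])
  qed
  finally show ?thesis
    by (simp add: avg_def sum_distrib_left[symmetric])
qed

lemma sum_abs_avg_le:
  assumes "integrable unit_leb f"
  shows "(\<Sum>j<2 ^ n. \<bar>avg n f j\<bar>) \<le> 2 ^ n * (\<integral>s. \<bar>f s\<bar> \<partial>unit_leb)"
proof -
  have "(\<Sum>j<2 ^ n. \<bar>avg n f j\<bar>) \<le> (\<Sum>j<2 ^ n. avg n (\<lambda>s. \<bar>f s\<bar>) j)"
    by (intro sum_mono abs_avg_le assms)
  then show ?thesis
    using sum_avg[of "\<lambda>s. \<bar>f s\<bar>" n] assms by simp
qed

lemma avg_nonneg: "(\<And>s. 0 \<le> f s) \<Longrightarrow> 0 \<le> avg n f j"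
  by (simp add: avg_def)

text \<open>The tower property of conditional expectation. Both families of averages agree at level
  \<open>m\<close>, and the martingale property carries the agreement down to level
  \<open>n\<close>.\<close>

lemma avg_step_avg:
  assumes f: "integrable unit_leb f" and "n \<le> m" "j < 2 ^ n"
  shows "avg n (step m (avg m f)) j = avg n f j"
  using assms(2,3)
proof (induction n arbitrary: j rule: inc_induct)
  case base
  then show ?case by (rule avg_step)
next
  case (step n)
  then show ?case
    by (simp add: avg_refine[OF f, of n] avg_refine[OF integrable_step, of n])
qed

section \<open>The space L^1[0,1)\<close>

definition L1_gauge :: "(real \<Rightarrow> real) \<Rightarrow> real \<Rightarrow> bool" where
  "L1_gauge f c \<longleftrightarrow> integrable unit_leb f \<and> (\<integral>s. \<bar>f s\<bar> \<partial>unit_leb) \<le> c"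

lemma norm_gauge_L1: "norm_gauge L1_gauge"
  unfolding norm_gauge_def
proof (intro conjI allI impI)
  show "L1_gauge 0 0"
    by (simp add: L1_gauge_def zero_fun_def)
next
  fix f c assume "L1_gauge f c"
  then show "0 \<le> c"
    unfolding L1_gauge_def by (meson Bochner_Integration.integral_nonneg abs_ge_zero order_trans)
next
  fix f c d assume "L1_gauge f c" "c \<le> d"
  then show "L1_gauge f d"
    by (simp add: L1_gauge_def)
next
  fix r f g c d assume h: "L1_gauge f c" "L1_gauge g d"
  then have int: "integrable unit_leb f" "integrable unit_leb g"
    by (auto simp: L1_gauge_def)
  have "(\<integral>s. \<bar>r * f s + g s\<bar> \<partial>unit_leb) \<le> (\<integral>s. \<bar>r\<bar> * \<bar>f s\<bar> + \<bar>g s\<bar> \<partial>unit_leb)"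
    using int by (intro integral_mono) (auto simp: abs_mult[symmetric] abs_triangle_ineq)
  also have "\<dots> = \<bar>r\<bar> * (\<integral>s. \<bar>f s\<bar> \<partial>unit_leb) + (\<integral>s. \<bar>g s\<bar> \<partial>unit_leb)"
    using int by simp
  also have "\<dots> \<le> \<bar>r\<bar> * c + d"
    using h by (intro add_mono mult_left_mono) (auto simp: L1_gauge_def)
  finally show "L1_gauge (r *\<^sub>R f + g) (\<bar>r\<bar> * c + d)"
    using int by (simp add: L1_gauge_def plus_fun_def)
qed

lemma eqv_L1I:
  assumes "integrable unit_leb f" "integrable unit_leb g" "AE s in unit_leb. f s = g s"
  shows "eqv L1_gauge f g"
proof -
  have "(\<integral>s. \<bar>f s - g s\<bar> \<partial>unit_leb) = (\<integral>s. 0 \<partial>unit_leb)"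
    using assms by (intro integral_cong_AE) auto
  then show ?thesis
    using assms by (simp add: eqv_def L1_gauge_def fun_diff_def)
qed

section \<open>Limits of dyadic martingales\<close>

text \<open>Tychonoff's theorem: the evaluations x -> x m lie in a product of compact intervals, one
  for each sequence x, and so have a cluster point. Along the filter of indices at which the
  evaluations approach it, all bounded sequences converge at once.\<close>

lemma ex_limit_filter:
  "\<exists>G::nat filter. G \<noteq> bot \<and> G \<le> sequentially \<and> (\<forall>x::nat \<Rightarrow> real. Bseq x \<longrightarrow> (\<exists>l. (x \<longlongrightarrow> l) G))"
proof -
  \<comment> \<open>The default 0 at unbounded sequences keeps every coordinate of
    \<open>e m\<close> bounded in \<open>m\<close>, so that all \<open>e m\<close> lie in one
    compact box.\<close>
  define e where "e = (\<lambda>(m::nat) (x::nat \<Rightarrow> real). if Bseq x then x m else 0)"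
  have "\<exists>b. \<forall>m. \<bar>e m x\<bar> \<le> b" for x
  proof (cases "Bseq x")
    case True
    then obtain c where "\<And>n. norm (x n) \<le> c"
      unfolding Bseq_def by blast
    then show ?thesis
      using True by (auto simp: e_def)
  qed (auto simp: e_def)
  then obtain b where b: "\<And>x m. \<bar>e m x\<bar> \<le> b x"
    by metis
  define K where "K = (\<Pi>\<^sub>E x\<in>UNIV. {- b x..b x})"
  have "compactin (product_topology (\<lambda>_. euclidean) UNIV) K"
    unfolding K_def compactin_PiE by simp
  then have "compact K"
    by (simp add: euclidean_product_topology)
  moreover have "filtermap e sequentially \<noteq> bot"
    by (simp add: filtermap_bot_iff)
  moreover have "eventually (\<lambda>f. f \<in> K) (filtermap e sequentially)"
    using b by (auto simp: eventually_filtermap K_def PiE_iff abs_le_iff minus_le_iff)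
  ultimately obtain \<phi> where \<phi>: "inf (nhds \<phi>) (filtermap e sequentially) \<noteq> bot"
    unfolding compact_filter by blast
  \<comment> \<open>Pulling the neighbourhoods of \<phi> back along \<open>e\<close> forces
    convergence to \<phi>. The filter is proper because \<phi> is a cluster point: disjoint members
    of the two filters would yield a neighbourhood of \<phi> that \<open>e\<close> eventually
    avoids.\<close>
  define G where "G = inf sequentially (filtercomap e (nhds \<phi>))"
  have "G \<noteq> bot"
  proof
    assume "G = bot"
    then have "eventually (\<lambda>_. False) G"
      by simp
    then obtain Q R where Q: "eventually Q sequentially" and R: "eventually R (filtercomap e (nhds \<phi>))"
      and QR: "\<And>m. Q m \<Longrightarrow> R m \<Longrightarrow> False"
      unfolding G_def eventually_inf by blast
    obtain P where P: "eventually P (nhds \<phi>)" "\<And>m. P (e m) \<Longrightarrow> R m"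
      using R unfolding eventually_filtercomap by blast
    have "eventually (\<lambda>f. \<not> P f) (filtermap e sequentially)"
      unfolding eventually_filtermap using Q by (rule eventually_mono) (use P QR in blast)
    then have "eventually (\<lambda>_. False) (inf (nhds \<phi>) (filtermap e sequentially))"
      unfolding eventually_inf using P(1) by blast
    then show False
      using \<phi> by (simp add: eventually_False)
  qed
  moreover have "G \<le> sequentially"
    by (simp add: G_def)
  moreover have "(x \<longlongrightarrow> \<phi> x) G" if "Bseq x" for x
  proof -
    have "(e \<longlongrightarrow> \<phi>) G"
      unfolding G_def using filterlim_filtercomap[of e "nhds \<phi>"] filterlim_mono by fastforce
    then have "((\<lambda>m. e m x) \<longlongrightarrow> \<phi> x) G"
      by (rule continuous_on_tendsto_compose[OF continuous_on_product_coordinates[of x]]) auto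
    then show ?thesis
      using that by (simp add: e_def)
  qed
  ultimately show ?thesis
    by blast
qed

text \<open>Convergence in measure, in the form of its subsequence criterion.\<close>

definition conv_AE_subseq :: "(nat \<Rightarrow> real \<Rightarrow> real) \<Rightarrow> (real \<Rightarrow> real) \<Rightarrow> bool" where
  "conv_AE_subseq M h \<longleftrightarrow> h \<in> borel_measurable unit_leb \<and>
     (\<forall>q::nat \<Rightarrow> nat. strict_mono q \<longrightarrow>
       (\<exists>r. strict_mono r \<and> (AE s in unit_leb. (\<lambda>k. M (q (r k)) s) \<longlonglongrightarrow> h s)))"

lemma conv_AE_subseqE:
  fixes q :: "nat \<Rightarrow> nat"
  assumes "conv_AE_subseq M h" "strict_mono q"
  obtains r where "strict_mono r" "AE s in unit_leb. (\<lambda>k. M (q (r k)) s) \<longlonglongrightarrow> h s"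
  using assms unfolding conv_AE_subseq_def by blast

text \<open>This is why the criterion speaks about every subsequence \<open>q\<close>: the second
  extraction is made inside the first, and almost everywhere convergence survives further thinning.
  Uniqueness and linearity of the limit follow from it.\<close>

lemma conv_AE_subseq_common:
  fixes q :: "nat \<Rightarrow> nat"
  assumes "conv_AE_subseq M h" "conv_AE_subseq N g" "strict_mono q"
  obtains r where "strict_mono r" "AE s in unit_leb. (\<lambda>k. M (q (r k)) s) \<longlonglongrightarrow> h s"
    "AE s in unit_leb. (\<lambda>k. N (q (r k)) s) \<longlonglongrightarrow> g s"
proof -
  obtain r where r: "strict_mono r" "AE s in unit_leb. (\<lambda>k. M (q (r k)) s) \<longlonglongrightarrow> h s"
    using conv_AE_subseqE[OF assms(1,3)] .
  obtain r' where r': "strict_mono r'" "AE s in unit_leb. (\<lambda>k. N ((q \<circ> r) (r' k)) s) \<longlonglongrightarrow> g s"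
    using conv_AE_subseqE[OF assms(2) strict_mono_o[OF assms(3) r(1)]] .
  have "AE s in unit_leb. (\<lambda>k. M (q (r (r' k))) s) \<longlonglongrightarrow> h s"
    using r(2) by eventually_elim (use LIMSEQ_subseq_LIMSEQ[OF _ r'(1)] in \<open>force simp: o_def\<close>)
  then show ?thesis
    using that[of "r \<circ> r'"] r' strict_mono_o[OF r(1) r'(1)] by simp
qed

lemma conv_AE_subseq_unique:
  assumes "conv_AE_subseq M h" "conv_AE_subseq M g"
  shows "AE s in unit_leb. h s = g s"
proof -
  obtain r where "AE s in unit_leb. (\<lambda>k. M (id (r k)) s) \<longlonglongrightarrow> h s"
    "AE s in unit_leb. (\<lambda>k. M (id (r k)) s) \<longlonglongrightarrow> g s"
    using conv_AE_subseq_common[OF assms strict_mono_id] .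
  then show ?thesis
    by eventually_elim (rule LIMSEQ_unique)
qed

lemma conv_AE_subseq_combination:
  assumes M: "conv_AE_subseq M h" and N: "conv_AE_subseq N g"
  shows "conv_AE_subseq (\<lambda>n s. c * M n s + N n s) (\<lambda>s. c * h s + g s)"
  unfolding conv_AE_subseq_def
proof (intro conjI allI impI)
  show "(\<lambda>s. c * h s + g s) \<in> borel_measurable unit_leb"
    using M[unfolded conv_AE_subseq_def, THEN conjunct1] N[unfolded conv_AE_subseq_def, THEN conjunct1]
    by measurable
  fix q :: "nat \<Rightarrow> nat" assume "strict_mono q"
  then obtain r where r: "strict_mono r" "AE s in unit_leb. (\<lambda>k. M (q (r k)) s) \<longlonglongrightarrow> h s"
    "AE s in unit_leb. (\<lambda>k. N (q (r k)) s) \<longlonglongrightarrow> g s"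
    using conv_AE_subseq_common[OF M N] by blast
  have "AE s in unit_leb. (\<lambda>k. c * M (q (r k)) s + N (q (r k)) s) \<longlonglongrightarrow> c * h s + g s"
    using r(2,3) by eventually_elim (intro tendsto_intros)
  then show "\<exists>r. strict_mono r \<and> (AE s in unit_leb. (\<lambda>k. c * M (q (r k)) s + N (q (r k)) s) \<longlonglongrightarrow> c * h s + g s)"
    using r(1) by blast
qed

lemma conv_AE_subseq_L1:
  assumes M: "\<And>n. integrable unit_leb (M n)" and h: "integrable unit_leb h"
    and lim: "(\<lambda>n. \<integral>s. \<bar>M n s - h s\<bar> \<partial>unit_leb) \<longlonglongrightarrow> 0"
  shows "conv_AE_subseq M h"
  unfolding conv_AE_subseq_def
proof (intro conjI allI impI)
  show "h \<in> borel_measurable unit_leb"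
    using h by measurable
  fix q :: "nat \<Rightarrow> nat" assume "strict_mono q"
  then have "(\<lambda>n. \<integral>s. norm (M (q n) s - h s) \<partial>unit_leb) \<longlonglongrightarrow> 0"
    using LIMSEQ_subseq_LIMSEQ[OF lim] by (simp add: o_def)
  then obtain r where r: "strict_mono r" "AE s in unit_leb. (\<lambda>k. M (q (r k)) s - h s) \<longlonglongrightarrow> 0"
    using tendsto_L1_AE_subseq[of unit_leb "\<lambda>n s. M (q n) s - h s"] M h by auto
  have "AE s in unit_leb. (\<lambda>k. M (q (r k)) s) \<longlonglongrightarrow> h s"
    using r(2) by eventually_elim (rule LIM_zero_cancel)
  then show "\<exists>r. strict_mono r \<and> (AE s in unit_leb. (\<lambda>k. M (q (r k)) s) \<longlonglongrightarrow> h s)"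
    using r(1) by blast
qed

text \<open>Fatou's lemma along an almost everywhere convergent subsequence. Only an inequality can
  hold, since mass may concentrate on null sets; in this way the singular part disappears.\<close>

lemma conv_AE_subseq_Fatou:
  assumes conv: "conv_AE_subseq M h" and M: "\<And>n. integrable unit_leb (M n)"
    and C: "\<And>n. (\<integral>s. \<bar>M n s\<bar> \<partial>unit_leb) \<le> C"
  shows "integrable unit_leb h" "(\<integral>s. \<bar>h s\<bar> \<partial>unit_leb) \<le> C"
proof -
  have [measurable]: "h \<in> borel_measurable unit_leb" "\<And>n. M n \<in> borel_measurable unit_leb"
    using conv[unfolded conv_AE_subseq_def, THEN conjunct1] M by auto
  obtain r where r: "AE s in unit_leb. (\<lambda>k. M (id (r k)) s) \<longlonglongrightarrow> h s"
    using conv_AE_subseqE[OF conv strict_mono_id] .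
  have "(\<integral>\<^sup>+s. ennreal \<bar>h s\<bar> \<partial>unit_leb) = (\<integral>\<^sup>+s. liminf (\<lambda>k. ennreal \<bar>M (r k) s\<bar>) \<partial>unit_leb)"
  proof (rule nn_integral_cong_AE, use r in eventually_elim)
    fix s assume "(\<lambda>k. M (id (r k)) s) \<longlonglongrightarrow> h s"
    then have "(\<lambda>k. ennreal \<bar>M (r k) s\<bar>) \<longlonglongrightarrow> ennreal \<bar>h s\<bar>"
      by (intro tendsto_ennrealI tendsto_rabs) simp
    then show "ennreal \<bar>h s\<bar> = liminf (\<lambda>k. ennreal \<bar>M (r k) s\<bar>)"
      using lim_imp_Liminf[of sequentially] by fastforce
  qed
  also have "\<dots> \<le> liminf (\<lambda>k. \<integral>\<^sup>+s. ennreal \<bar>M (r k) s\<bar> \<partial>unit_leb)"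
    by (intro nn_integral_liminf) measurable
  also have "\<dots> \<le> liminf (\<lambda>k::nat. ennreal C)"
  proof (intro Liminf_mono always_eventually allI)
    fix k show "(\<integral>\<^sup>+s. ennreal \<bar>M (r k) s\<bar> \<partial>unit_leb) \<le> ennreal C"
      using C[of "r k"] M[of "r k"] by (subst nn_integral_eq_integral) (auto intro: ennreal_leI)
  qed
  also have "\<dots> = ennreal C"
    by (simp add: Liminf_const)
  finally have le: "(\<integral>\<^sup>+s. ennreal \<bar>h s\<bar> \<partial>unit_leb) \<le> ennreal C" .
  then show int: "integrable unit_leb h"
    by (intro integrableI_bounded) (auto intro: le_less_trans)
  have "0 \<le> C"
    using C[of 0] by (rule order_trans[rotated]) simp
  then show "(\<integral>s. \<bar>h s\<bar> \<partial>unit_leb) \<le> C"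
    using le int by (subst (asm) nn_integral_eq_integral) auto
qed

section \<open>Dyadic submartingales\<close>

text \<open>In probabilistic terms, E(G Y_n) <= E(G Y_(n+k)) for a nonnegative weight G that is
  known at level \<open>n\<close>. The weight stays constant on the cells of level \<open>n\<close>
  while \<open>y\<close> is refined one level at a time.\<close>

lemma submartingale_weighted_integral_mono:
  fixes y :: "nat \<Rightarrow> nat \<Rightarrow> real"
  assumes y: "\<And>n j. 2 * y n j \<le> y (Suc n) (2 * j) + y (Suc n) (2 * j + 1)" and G: "\<And>j. 0 \<le> G j"
  shows "(\<integral>s. step n (\<lambda>j. G j * y n j) s \<partial>unit_leb)
    \<le> (\<integral>s. step (n + k) (\<lambda>j. G (j div 2 ^ k) * y (n + k) j) s \<partial>unit_leb)"
proof (induction k)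
  case (Suc k)
  have "(\<Sum>j<2 ^ (n + k). G (j div 2 ^ k) * (2 * y (n + k) j)) \<le>
      (\<Sum>j<2 ^ (n + k). G (j div 2 ^ k) * (y (Suc (n + k)) (2 * j) + y (Suc (n + k)) (2 * j + 1)))"
    by (intro sum_mono mult_left_mono y G)
  also have "\<dots> = (\<Sum>j<2 * 2 ^ (n + k). G (j div 2 ^ Suc k) * y (Suc (n + k)) j)"
    unfolding sum_even_odd by (intro sum.cong refl) (simp add: div_mult2_eq distrib_left)
  finally have "2 * (\<Sum>j<2 ^ (n + k). G (j div 2 ^ k) * y (n + k) j)
      \<le> (\<Sum>j<2 ^ (n + Suc k). G (j div 2 ^ Suc k) * y (n + Suc k) j)"
    by (simp add: sum_distrib_left mult.left_commute)
  then have "(\<integral>s. step (n + k) (\<lambda>j. G (j div 2 ^ k) * y (n + k) j) s \<partial>unit_leb) \<le>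
      (\<integral>s. step (n + Suc k) (\<lambda>j. G (j div 2 ^ Suc k) * y (n + Suc k) j) s \<partial>unit_leb)"
    unfolding integral_step by (simp add: field_simps)
  with Suc show ?case
    by (rule order_trans)
qed simp

text \<open>Expand the square. The cross term satisfies E(Y_n Y_(n+k)) >= E(Y_n^2), by the
  submartingale inequality with \<open>y n\<close> itself as the nonnegative weight.\<close>

lemma submartingale_L2_increment:
  fixes y :: "nat \<Rightarrow> nat \<Rightarrow> real"
  assumes y: "\<And>n j. 2 * y n j \<le> y (Suc n) (2 * j) + y (Suc n) (2 * j + 1)" and "\<And>n j. 0 \<le> y n j"
  shows "(\<integral>s. (step (n + k) (y (n + k)) s - step n (y n) s)\<^sup>2 \<partial>unit_leb) \<le>
    (\<integral>s. (step (n + k) (y (n + k)) s)\<^sup>2 \<partial>unit_leb) - (\<integral>s. (step n (y n) s)\<^sup>2 \<partial>unit_leb)"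
proof -
  \<comment> \<open>The product of the two step functions, written as one step function of level
    \<open>n + k\<close>.\<close>
  let ?c = "\<lambda>j. y n (j div 2 ^ k) * y (n + k) j"
  have "(\<integral>s. (step (n + k) (y (n + k)) s - step n (y n) s)\<^sup>2 \<partial>unit_leb) =
      (\<integral>s. (step (n + k) (y (n + k)) s)\<^sup>2 + (step n (y n) s)\<^sup>2 - 2 * step (n + k) ?c s \<partial>unit_leb)"
    by (intro Bochner_Integration.integral_cong refl)
      (simp add: space_restrict_space step_def index_div power2_diff)
  also have "\<dots> = (\<integral>s. (step (n + k) (y (n + k)) s)\<^sup>2 \<partial>unit_leb) + (\<integral>s. (step n (y n) s)\<^sup>2 \<partial>unit_leb)
      - 2 * (\<integral>s. step (n + k) ?c s \<partial>unit_leb)"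
    by (simp add: step_compose[of "\<lambda>x. x\<^sup>2"] integrable_step)
  finally have eq: "(\<integral>s. (step (n + k) (y (n + k)) s - step n (y n) s)\<^sup>2 \<partial>unit_leb) = \<dots>" .
  have "(\<integral>s. step n (\<lambda>j. y n j * y n j) s \<partial>unit_leb) \<le> (\<integral>s. step (n + k) ?c s \<partial>unit_leb)"
    by (intro submartingale_weighted_integral_mono assms)
  then have "(\<integral>s. (step n (y n) s)\<^sup>2 \<partial>unit_leb) \<le> (\<integral>s. step (n + k) ?c s \<partial>unit_leb)"
    by (simp only: step_def power2_eq_square)
  then show ?thesis
    using eq by linarith
qed

text \<open>Midpoint convexity, which makes exp(-M) a submartingale when M is a martingale. It is
  the expanded square of a difference of half-exponentials.\<close>

lemma exp_minus_midpoint: "2 * exp (- ((a + b) / 2)) \<le> exp (- a) + exp (- b)" for a b :: real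
proof -
  have "0 \<le> (exp (- a / 2) - exp (- b / 2))\<^sup>2"
    by simp
  also have "\<dots> = exp (- a) + exp (- b) - 2 * exp (- ((a + b) / 2))"
    by (simp add: power2_diff exp_double[symmetric] mult_exp_exp add_divide_distrib)
  finally show ?thesis by simp
qed

text \<open>The sum of the absolute increments has a finite integral, so it is finite almost
  everywhere, and there the telescoping series converges.\<close>

lemma AE_convergent_of_summable_L1:
  fixes Z :: "nat \<Rightarrow> real \<Rightarrow> real"
  assumes Z: "\<And>k. integrable M (Z k)"
    and le: "\<And>k. (\<integral>s. \<bar>Z (Suc k) s - Z k s\<bar> \<partial>M) \<le> a k" and a: "summable a"
  shows "AE s in M. convergent (\<lambda>k. Z k s)"
proof -
  have [measurable]: "Z k \<in> borel_measurable M" for k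
    using Z by auto
  have nn: "0 \<le> a k" for k
    using le[of k] by (rule order_trans[rotated]) simp
  have "(\<integral>\<^sup>+s. (\<Sum>k. ennreal \<bar>Z (Suc k) s - Z k s\<bar>) \<partial>M) = (\<Sum>k. \<integral>\<^sup>+s. ennreal \<bar>Z (Suc k) s - Z k s\<bar> \<partial>M)"
    by (intro nn_integral_suminf) measurable
  also have "\<dots> \<le> (\<Sum>k. ennreal (a k))"
    using le Z by (intro suminf_le) (auto simp: nn_integral_eq_integral intro: ennreal_leI)
  also have "\<dots> < \<infinity>"
    using suminf_ennreal_eq[OF nn summable_sums[OF a]] by simp
  finally have "AE s in M. (\<Sum>k. ennreal \<bar>Z (Suc k) s - Z k s\<bar>) \<noteq> \<infinity>"
    by (intro nn_integral_PInf_AE) auto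
  then show ?thesis
  proof eventually_elim
    fix s assume "(\<Sum>k. ennreal \<bar>Z (Suc k) s - Z k s\<bar>) \<noteq> \<infinity>"
    then have "summable (\<lambda>k. \<bar>Z (Suc k) s - Z k s\<bar>)"
      by (intro summable_suminf_not_top) auto
    then have "summable (\<lambda>k. Z (Suc k) s - Z k s)"
      by (rule summable_rabs_cancel)
    then have "convergent (\<lambda>n. Z n s - Z 0 s)"
      using sum_lessThan_telescope[of "\<lambda>k. Z k s"] by (simp only: summable_iff_convergent)
    then show "convergent (\<lambda>k. Z k s)"
      using convergent_add_const_right_iff[of "\<lambda>n. Z n s" "- Z 0 s"] by simp
  qed
qed

text \<open>Convergence of a nonnegative martingale \<open>M\<close> is read off from the bounded submartingale
  \<open>exp (- M)\<close>, which is Cauchy in \<open>L\<^sup>2\<close> because its second moments increase.\<close>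

lemma bounded_submartingale_L1_limit:
  fixes y :: "nat \<Rightarrow> nat \<Rightarrow> real"
  assumes sub: "\<And>n j. 2 * y n j \<le> y (Suc n) (2 * j) + y (Suc n) (2 * j + 1)"
    and y: "\<And>n j. 0 \<le> y n j" "\<And>n j. y n j \<le> 1"
  obtains Y where "integrable unit_leb Y" "(\<lambda>n. \<integral>s. \<bar>step n (y n) s - Y s\<bar> \<partial>unit_leb) \<longlonglongrightarrow> 0"
proof -
  \<comment> \<open>The second moments increase and are bounded by 1; their convergence is what
    makes the sequence Cauchy.\<close>
  define e where "e n = (\<integral>s. (step n (y n) s)\<^sup>2 \<partial>unit_leb)" for n
  have int: "integrable unit_leb (step n (y n))" "integrable unit_leb (\<lambda>s. (step n (y n) s)\<^sup>2)" for n
    by (auto simp: step_compose[of "\<lambda>x. x\<^sup>2"] integrable_step)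
  have bd: "0 \<le> step n (y n) s" "step n (y n) s \<le> 1" for n s
    by (auto simp: step_def y)
  have diff: "\<bar>step m (y m) s - step n (y n) s\<bar> \<le> 1" for m n s
    using bd[of m s] bd[of n s] by linarith
  have int2: "integrable unit_leb (\<lambda>s. (step m (y m) s - step n (y n) s)\<^sup>2)" for m n
    by (rule finite_measure.integrable_const_bound[OF finite_measure_unit_leb, of _ 1])
      (use diff[of m _ n] int(1) in \<open>auto simp: abs_square_le_1\<close>)
  have inc: "(\<integral>s. (step m (y m) s - step n (y n) s)\<^sup>2 \<partial>unit_leb) \<le> e m - e n" if "n \<le> m" for m n
    using submartingale_L2_increment[where y = y, OF sub y(1), of n "m - n"] that by (simp add: e_def)
  have "incseq e"
  proof (rule incseq_SucI)
    fix n show "e n \<le> e (Suc n)"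
      using order_trans[OF _ inc[of n "Suc n"], of 0] by simp
  qed
  moreover have "e n \<le> 1" for n
  proof -
    have "e n \<le> (\<integral>s. 1 \<partial>unit_leb)"
      unfolding e_def using bd by (intro integral_mono int) (auto simp: power_le_one)
    then show ?thesis
      by (simp add: measure_unit_leb)
  qed
  ultimately obtain E where E: "e \<longlonglongrightarrow> E" "\<And>n. e n \<le> E"
    using incseq_convergent[of e 1] by blast
  have L1: "(\<integral>s. \<bar>step m (y m) s - step n (y n) s\<bar> \<partial>unit_leb) \<le> \<epsilon> + (E - e n) / \<epsilon>"
    if "n \<le> m" "0 < \<epsilon>" for m n \<epsilon>
  proof -
    \<comment> \<open>Passes from L^2 to L^1: where the absolute value exceeds \<epsilon>, dividing
      the square by \<epsilon> can only enlarge it. The parameter \<epsilon> is balanced against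
      \<open>E - e n\<close> later.\<close>
    have le: "\<bar>x\<bar> \<le> \<epsilon> + x\<^sup>2 / \<epsilon>" for x
    proof (cases "\<bar>x\<bar> \<le> \<epsilon>")
      case True
      moreover have "0 \<le> x\<^sup>2 / \<epsilon>"
        using \<open>0 < \<epsilon>\<close> by simp
      ultimately show ?thesis by linarith
    next
      case False
      then have "\<epsilon> * \<bar>x\<bar> \<le> \<bar>x\<bar> * \<bar>x\<bar>"
        by (intro mult_right_mono) auto
      then have "\<bar>x\<bar> \<le> x\<^sup>2 / \<epsilon>"
        using \<open>0 < \<epsilon>\<close> by (simp add: field_simps power2_eq_square)
      then show ?thesis
        using \<open>0 < \<epsilon>\<close> by linarith
    qed
    have "(\<integral>s. \<bar>step m (y m) s - step n (y n) s\<bar> \<partial>unit_leb) \<le>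
        (\<integral>s. \<epsilon> + (step m (y m) s - step n (y n) s)\<^sup>2 / \<epsilon> \<partial>unit_leb)"
      using int int2 le by (intro integral_mono) auto
    also have "\<dots> = \<epsilon> + (\<integral>s. (step m (y m) s - step n (y n) s)\<^sup>2 \<partial>unit_leb) / \<epsilon>"
      using int2 by (subst Bochner_Integration.integral_add) (auto simp: measure_unit_leb)
    also have "\<dots> \<le> \<epsilon> + (E - e n) / \<epsilon>"
      using inc[OF that(1)] E(2)[of m] that(2) by (auto simp: divide_le_cancel)
    finally show ?thesis .
  qed
  \<comment> \<open>The rate 4^-k matches the choice \<epsilon> = 2^-k: both terms of
    \<open>L1\<close> are then at most 2^-k, and the increments are summable.\<close>
  have "\<exists>N. \<forall>n\<ge>N. E - e n \<le> (1/4) ^ k" for k :: nat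
  proof -
    have "eventually (\<lambda>n. E - (1/4) ^ k < e n) sequentially"
      using E(1) by (rule order_tendstoD) simp
    then have "eventually (\<lambda>n. E - e n \<le> (1/4) ^ k) sequentially"
      by eventually_elim linarith
    then show ?thesis
      unfolding eventually_sequentially .
  qed
  then obtain N where N: "\<And>k n. N k \<le> n \<Longrightarrow> E - e n \<le> (1/4) ^ k"
    by metis
  \<comment> \<open>Summing makes \<open>r\<close> monotone and at least \<open>N k\<close>; the
    extra \<open>k\<close> makes it tend to infinity.\<close>
  define r where "r k = (\<Sum>i\<le>k. N i) + k" for k
  have r: "N k \<le> r k" "r k \<le> r (Suc k)" "k \<le> r k" for k
    by (auto simp: r_def intro: order_trans[OF member_le_sum[of k "{..k}" N]])
  have "(\<integral>s. \<bar>step (r (Suc k)) (y (r (Suc k))) s - step (r k) (y (r k)) s\<bar> \<partial>unit_leb) \<le> 2 * (1/2) ^ k" for k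
  proof -
    have "(E - e (r k)) / (1/2) ^ k \<le> (1/4) ^ k / (1/2) ^ k"
      using N[OF r(1)] by (intro divide_right_mono) auto
    also have "\<dots> = (1/2) ^ k"
      by (simp add: power_divide[symmetric])
    finally show ?thesis
      using L1[OF r(2)[of k], of "(1/2) ^ k"] by simp
  qed
  then have ae: "AE s in unit_leb. convergent (\<lambda>k. step (r k) (y (r k)) s)"
    by (rule AE_convergent_of_summable_L1[OF int(1)])
      (intro summable_mult summable_geometric, simp)
  \<comment> \<open>Where the subsequence diverges, \<open>lim\<close> is an unspecified value, but
    this happens only on a null set.\<close>
  define Y where "Y s = lim (\<lambda>k. step (r k) (y (r k)) s)" for s
  have [measurable]: "\<And>n. step n (y n) \<in> borel_measurable unit_leb"
    using int(1) by auto
  have Y [measurable]: "Y \<in> borel_measurable unit_leb"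
    unfolding Y_def by measurable
  have lim: "AE s in unit_leb. (\<lambda>k. step (r k) (y (r k)) s) \<longlonglongrightarrow> Y s"
    using ae by eventually_elim (simp add: Y_def convergent_LIMSEQ_iff)
  have "AE s in unit_leb. norm (Y s) \<le> 1"
    using lim
  proof eventually_elim
    fix s assume "(\<lambda>k. step (r k) (y (r k)) s) \<longlonglongrightarrow> Y s"
    then have "(\<lambda>k. \<bar>step (r k) (y (r k)) s\<bar>) \<longlonglongrightarrow> \<bar>Y s\<bar>"
      by (rule tendsto_rabs)
    then show "norm (Y s) \<le> 1"
      using bd by (intro LIMSEQ_le_const2) auto
  qed
  then have intY: "integrable unit_leb Y"
    by (rule finite_measure.integrable_const_bound[OF finite_measure_unit_leb]) measurable
  \<comment> \<open>The Cauchy estimate with its second index sent to infinity along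
    \<open>r\<close>. It controls the distance to \<open>Y\<close> for all \<open>n\<close>, not
    only along the subsequence.\<close>
  have bound: "(\<integral>s. \<bar>step n (y n) s - Y s\<bar> \<partial>unit_leb) \<le> \<epsilon> + (E - e n) / \<epsilon>" if "0 < \<epsilon>" for n \<epsilon>
  proof (rule LIMSEQ_le_const2)
    show "(\<lambda>k. \<integral>s. \<bar>step n (y n) s - step (r k) (y (r k)) s\<bar> \<partial>unit_leb) \<longlonglongrightarrow> (\<integral>s. \<bar>step n (y n) s - Y s\<bar> \<partial>unit_leb)"
    proof (rule integral_dominated_convergence[where w = "\<lambda>_. 1"])
      show "AE s in unit_leb. (\<lambda>k. \<bar>step n (y n) s - step (r k) (y (r k)) s\<bar>) \<longlonglongrightarrow> \<bar>step n (y n) s - Y s\<bar>"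
        using lim by eventually_elim (intro tendsto_intros)
    qed (use diff in auto)
    show "\<exists>N. \<forall>k\<ge>N. (\<integral>s. \<bar>step n (y n) s - step (r k) (y (r k)) s\<bar> \<partial>unit_leb) \<le> \<epsilon> + (E - e n) / \<epsilon>"
    proof (intro exI allI impI)
      fix k assume "n \<le> k"
      then show "(\<integral>s. \<bar>step n (y n) s - step (r k) (y (r k)) s\<bar> \<partial>unit_leb) \<le> \<epsilon> + (E - e n) / \<epsilon>"
        using L1[OF order_trans[OF \<open>n \<le> k\<close> r(3)] that] by (simp add: abs_minus_commute)
    qed
  qed
  have "(\<lambda>n. \<integral>s. \<bar>step n (y n) s - Y s\<bar> \<partial>unit_leb) \<longlonglongrightarrow> 0"
  proof (rule tendstoI)
    fix \<eta> :: real assume \<eta>: "0 < \<eta>"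
    have "((\<lambda>n. \<eta> / 2 + (E - e n) / (\<eta> / 2)) \<longlonglongrightarrow> \<eta> / 2 + (E - E) / (\<eta> / 2))"
      by (intro tendsto_intros E) (use \<eta> in auto)
    then have "eventually (\<lambda>n. \<eta> / 2 + (E - e n) / (\<eta> / 2) < \<eta>) sequentially"
      by (rule order_tendstoD) (use \<eta> in auto)
    then show "eventually (\<lambda>n. dist (\<integral>s. \<bar>step n (y n) s - Y s\<bar> \<partial>unit_leb) 0 < \<eta>) sequentially"
      by eventually_elim (use bound[of "\<eta> / 2"] \<eta> in \<open>auto intro: le_less_trans\<close>)
  qed
  then show ?thesis
    using intY that by blast
qed

text \<open>Doob's convergence theorem in the weaker form of convergence in measure. If exp(-M)
  tends to Y, then M tends to -ln Y wherever Y is positive; the content beyond the submartingale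
  limit is that Y vanishes only on a null set.\<close>

lemma nonneg_martingale_conv:
  fixes v :: "nat \<Rightarrow> nat \<Rightarrow> real"
  assumes v: "\<And>n j. v n j = (v (Suc n) (2 * j) + v (Suc n) (2 * j + 1)) / 2" "\<And>n j. 0 \<le> v n j"
  obtains h where "conv_AE_subseq (\<lambda>n. step n (v n)) h"
proof -
  define y where "y n j = exp (- v n j)" for n j
  have Y_eq: "step n (y n) s = exp (- step n (v n) s)" for n s
    by (simp add: y_def step_def)
  have sub: "2 * y n j \<le> y (Suc n) (2 * j) + y (Suc n) (2 * j + 1)" for n j
    unfolding y_def using exp_minus_midpoint v(1) by metis
  have y01: "0 \<le> y n j" "y n j \<le> 1" for n j
    by (auto simp: y_def v(2))
  obtain Y where Y: "integrable unit_leb Y"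
    and L1: "(\<lambda>n. \<integral>s. \<bar>step n (y n) s - Y s\<bar> \<partial>unit_leb) \<longlonglongrightarrow> 0"
    using bounded_submartingale_L1_limit[where y = y, OF sub y01] by blast
  have conv: "conv_AE_subseq (\<lambda>n. step n (y n)) Y"
    by (intro conv_AE_subseq_L1 integrable_step Y L1)
  obtain r where r: "AE s in unit_leb. (\<lambda>k. step (id (r k)) (y (id (r k))) s) \<longlonglongrightarrow> Y s"
    using conv_AE_subseqE[OF conv strict_mono_id] .
  \<comment> \<open>The expectation of the martingale is constant, so Fatou's lemma bounds the
    integral of its lower limit by \<open>v 0 0\<close>.\<close>
  have sum: "(\<Sum>j<2 ^ n. v n j) = 2 ^ n * v 0 0" for n
  proof (induction n)
    case (Suc n)
    have "(\<Sum>j<2 ^ n. v n j) = (\<Sum>j<2 ^ n. v (Suc n) (2 * j) + v (Suc n) (2 * j + 1)) / 2"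
      unfolding sum_divide_distrib by (intro sum.cong refl v(1))
    then show ?case
      using Suc sum_even_odd[of "v (Suc n)" "2 ^ n"] by simp
  qed simp
  have [measurable]: "step n (v n) \<in> borel_measurable unit_leb" for n
    using integrable_step by auto
  have "(\<integral>\<^sup>+s. liminf (\<lambda>k. ennreal (step (r k) (v (r k)) s)) \<partial>unit_leb) \<le>
      liminf (\<lambda>k. \<integral>\<^sup>+s. ennreal (step (r k) (v (r k)) s) \<partial>unit_leb)"
    by (intro nn_integral_liminf) measurable
  also have "\<dots> = liminf (\<lambda>k::nat. ennreal (v 0 0))"
    by (subst nn_integral_eq_integral) (auto simp: integrable_step integral_step sum step_def v(2))
  also have "\<dots> < \<infinity>"
    by (simp add: Liminf_const)
  finally have "AE s in unit_leb. liminf (\<lambda>k. ennreal (step (r k) (v (r k)) s)) \<noteq> \<infinity>"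
    by (intro nn_integral_PInf_AE) auto
  \<comment> \<open>At a zero of \<open>Y\<close> the martingale would tend to infinity along
    \<open>r\<close>, whereas its lower limit is finite almost everywhere.\<close>
  with r have pos: "AE s in unit_leb. 0 < Y s"
  proof eventually_elim
    fix s assume lim: "(\<lambda>k. step (id (r k)) (y (id (r k))) s) \<longlonglongrightarrow> Y s"
      and fin: "liminf (\<lambda>k. ennreal (step (r k) (v (r k)) s)) \<noteq> \<infinity>"
    have "0 \<le> Y s"
      using lim by (rule LIMSEQ_le_const) (auto simp: Y_eq)
    moreover have "Y s \<noteq> 0"
    proof
      assume "Y s = 0"
      then have "(\<lambda>k. exp (- step (r k) (v (r k)) s)) \<longlonglongrightarrow> 0"
        using lim by (simp add: Y_eq)
      then have "filterlim (\<lambda>k. inverse (exp (- step (r k) (v (r k)) s))) at_top sequentially"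
        by (rule filterlim_inverse_at_top) simp
      then have "filterlim (\<lambda>k. ln (exp (step (r k) (v (r k)) s))) at_top sequentially"
        by (intro filterlim_compose[OF ln_at_top]) (simp add: exp_minus)
      then have "(\<lambda>k. ennreal (step (r k) (v (r k)) s)) \<longlonglongrightarrow> top"
        by (simp add: ennreal_tendsto_top_eq_at_top)
      then show False
        using fin lim_imp_Liminf[of sequentially] by fastforce
    qed
    ultimately show "0 < Y s" by simp
  qed
  have "conv_AE_subseq (\<lambda>n. step n (v n)) (\<lambda>s. - ln (Y s))"
    unfolding conv_AE_subseq_def
  proof (intro conjI allI impI)
    show "(\<lambda>s. - ln (Y s)) \<in> borel_measurable unit_leb"
      using Y by measurable
    fix q :: "nat \<Rightarrow> nat" assume "strict_mono q"
    then obtain r' where r': "strict_mono r'"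
      "AE s in unit_leb. (\<lambda>k. step (q (r' k)) (y (q (r' k))) s) \<longlonglongrightarrow> Y s"
      using conv_AE_subseqE[OF conv] by blast
    have "AE s in unit_leb. (\<lambda>k. step (q (r' k)) (v (q (r' k))) s) \<longlonglongrightarrow> - ln (Y s)"
      using r'(2) pos
    proof eventually_elim
      fix s assume "(\<lambda>k. step (q (r' k)) (y (q (r' k))) s) \<longlonglongrightarrow> Y s" "0 < Y s"
      then have "(\<lambda>k. - ln (step (q (r' k)) (y (q (r' k))) s)) \<longlonglongrightarrow> - ln (Y s)"
        by (intro tendsto_intros) auto
      then show "(\<lambda>k. step (q (r' k)) (v (q (r' k))) s) \<longlonglongrightarrow> - ln (Y s)"
        by (simp add: Y_eq)
    qed
    then show "\<exists>r. strict_mono r \<and> (AE s in unit_leb. (\<lambda>k. step (q (r k)) (v (q (r k))) s) \<longlonglongrightarrow> - ln (Y s))"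
      using r'(1) by blast
  qed
  then show ?thesis
    by (rule that)
qed

section \<open>A projection of bounded sequences in L1 onto L1\<close>

lemma L1_dense_continuous:
  fixes f :: "real \<Rightarrow> real"
  assumes f: "integrable unit_leb f" and "0 < e"
  obtains g where "continuous_on UNIV g" "(\<integral>s. \<bar>f s - g s\<bar> \<partial>unit_leb) < e"
proof -
  \<comment> \<open>Clamping to [-K, K] is continuous. Applied to \<open>f\<close> it costs little
    in L^1, and applied to approximants it provides the constant that dominated convergence
    needs.\<close>
  define cl where "cl K x = max (- K) (min K x)" for K x :: real
  have cl: "\<bar>cl K x\<bar> \<le> \<bar>x\<bar>" "\<bar>cl K x\<bar> \<le> K" if "0 \<le> K" for K x
    using that by (auto simp: cl_def)
  have cont: "continuous_on UNIV (cl K)" for K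
    unfolding cl_def by (intro continuous_intros)
  have [measurable]: "f \<in> borel_measurable unit_leb" "cl K \<in> borel_measurable borel" for K
    using f cont by (auto intro: borel_measurable_continuous_onI)
  have "(\<lambda>k. \<integral>s. \<bar>f s - cl (real k) (f s)\<bar> \<partial>unit_leb) \<longlonglongrightarrow> (\<integral>s. 0 \<partial>unit_leb)"
  proof (rule integral_dominated_convergence[where w = "\<lambda>s. 2 * \<bar>f s\<bar>"])
    show "AE s in unit_leb. (\<lambda>k. \<bar>f s - cl (real k) (f s)\<bar>) \<longlonglongrightarrow> 0"
    proof (rule AE_I2)
      fix s
      have "eventually (\<lambda>k. \<bar>f s - cl (real k) (f s)\<bar> = 0) sequentially"
        using eventually_ge_at_top[of "nat \<lceil>\<bar>f s\<bar>\<rceil>"]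
      proof eventually_elim
        fix k assume "nat \<lceil>\<bar>f s\<bar>\<rceil> \<le> k"
        then have "\<bar>f s\<bar> \<le> real k"
          by linarith
        then show "\<bar>f s - cl (real k) (f s)\<bar> = 0"
          by (auto simp: cl_def)
      qed
      then show "(\<lambda>k. \<bar>f s - cl (real k) (f s)\<bar>) \<longlonglongrightarrow> 0"
        by (rule tendsto_eventually)
    qed
    show "AE s in unit_leb. norm \<bar>f s - cl (real k) (f s)\<bar> \<le> 2 * \<bar>f s\<bar>" for k
    proof (rule AE_I2)
      fix s show "norm \<bar>f s - cl (real k) (f s)\<bar> \<le> 2 * \<bar>f s\<bar>"
        using cl(1)[of "real k" "f s"] by simp
    qed
  qed (use f in auto)
  then have "eventually (\<lambda>k. (\<integral>s. \<bar>f s - cl (real k) (f s)\<bar> \<partial>unit_leb) < e / 2) sequentially"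
    using \<open>0 < e\<close> by (intro order_tendstoD) auto
  then obtain k :: nat where k: "(\<integral>s. \<bar>f s - cl (real k) (f s)\<bar> \<partial>unit_leb) < e / 2"
    by (auto dest: eventually_happens)
  \<comment> \<open>This yields continuous functions converging to \<open>f\<close> off a null set,
    but without any bound on them; hence they are clamped at the same height \<open>k\<close> as
    \<open>f\<close>.\<close>
  have "f measurable_on {0..<1}"
    by (rule measurable_on_iff_borel_measurable[THEN iffD2]) auto
  then obtain N g where N: "negligible N" and g: "\<And>n::nat. continuous_on UNIV (g n)"
    and lim: "\<And>s. s \<notin> N \<Longrightarrow> (\<lambda>n. g n s) \<longlonglongrightarrow> (if s \<in> {0..<1} then f s else 0)"
    unfolding measurable_on_def by blast
  have gc: "continuous_on UNIV (\<lambda>s. cl (real k) (g n s))" for n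
    by (rule continuous_on_compose2[OF cont g]) auto
  have gm [measurable]: "(\<lambda>s. cl (real k) (g n s)) \<in> borel_measurable unit_leb" for n
    using gc by (intro measurable_restrict_space1 measurable_completion)
      (auto intro: borel_measurable_continuous_onI)
  have bd: "integrable unit_leb u" if "u \<in> borel_measurable unit_leb" "\<And>s. \<bar>u s\<bar> \<le> real k" for u :: "real \<Rightarrow> real"
    using that by (intro finite_measure.integrable_const_bound[OF finite_measure_unit_leb, of _ "real k"]) auto
  have int: "integrable unit_leb (\<lambda>s. cl (real k) (f s))" "integrable unit_leb (\<lambda>s. cl (real k) (g n s))" for n
    using cl(2) by (auto intro!: bd)
  have "AE s in unit_leb. s \<notin> N"
    using AE_not_in[of N lebesgue] N
    by (auto simp: AE_restrict_space_iff negligible_iff_null_sets elim: eventually_mono)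
  then have "AE s in unit_leb. (\<lambda>n. \<bar>cl (real k) (f s) - cl (real k) (g n s)\<bar>) \<longlonglongrightarrow> 0"
    using AE_space
  proof eventually_elim
    fix s assume "s \<notin> N" "s \<in> space unit_leb"
    then have "(\<lambda>n. g n s) \<longlonglongrightarrow> f s"
      using lim by (force simp: space_restrict_space)
    then have "(\<lambda>n. cl (real k) (g n s)) \<longlonglongrightarrow> cl (real k) (f s)"
      by (rule continuous_on_tendsto_compose[OF cont]) auto
    from tendsto_rabs[OF tendsto_diff[OF tendsto_const this]]
    show "(\<lambda>n. \<bar>cl (real k) (f s) - cl (real k) (g n s)\<bar>) \<longlonglongrightarrow> 0"
      by (metis abs_zero diff_self)
  qed
  then have "(\<lambda>n. \<integral>s. \<bar>cl (real k) (f s) - cl (real k) (g n s)\<bar> \<partial>unit_leb) \<longlonglongrightarrow> (\<integral>s. 0 \<partial>unit_leb)"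
  proof (rule integral_dominated_convergence[where w = "\<lambda>s. 2 * real k", rotated 3])
    show "AE s in unit_leb. norm \<bar>cl (real k) (f s) - cl (real k) (g n s)\<bar> \<le> 2 * real k" for n
    proof (rule AE_I2)
      fix s show "norm \<bar>cl (real k) (f s) - cl (real k) (g n s)\<bar> \<le> 2 * real k"
        using cl(2)[of "real k" "f s"] cl(2)[of "real k" "g n s"] by simp
    qed
  qed auto
  then have "eventually (\<lambda>n. (\<integral>s. \<bar>cl (real k) (f s) - cl (real k) (g n s)\<bar> \<partial>unit_leb) < e / 2) sequentially"
    using \<open>0 < e\<close> by (intro order_tendstoD) auto
  then obtain n where n: "(\<integral>s. \<bar>cl (real k) (f s) - cl (real k) (g n s)\<bar> \<partial>unit_leb) < e / 2"
    by (auto dest: eventually_happens)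
  have "(\<integral>s. \<bar>f s - cl (real k) (g n s)\<bar> \<partial>unit_leb) \<le>
      (\<integral>s. \<bar>f s - cl (real k) (f s)\<bar> + \<bar>cl (real k) (f s) - cl (real k) (g n s)\<bar> \<partial>unit_leb)"
    using f int by (intro integral_mono) auto
  also have "\<dots> = (\<integral>s. \<bar>f s - cl (real k) (f s)\<bar> \<partial>unit_leb) +
      (\<integral>s. \<bar>cl (real k) (f s) - cl (real k) (g n s)\<bar> \<partial>unit_leb)"
    using f int by (intro Bochner_Integration.integral_add) auto
  finally have "(\<integral>s. \<bar>f s - cl (real k) (g n s)\<bar> \<partial>unit_leb) < e"
    using k n by linarith
  then show ?thesis
    using gc that by blast
qed

text \<open>Conditional expectation is a contraction of L^1.\<close>

lemma integral_abs_step_avg_le: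
  assumes "integrable unit_leb f"
  shows "(\<integral>s. \<bar>step n (avg n f) s\<bar> \<partial>unit_leb) \<le> (\<integral>s. \<bar>f s\<bar> \<partial>unit_leb)"
  unfolding step_compose integral_step using sum_abs_avg_le[OF assms, of n] by (simp add: field_simps)

text \<open>Once cells are shorter than the modulus of uniform continuity for \<open>e\<close>, a
  value of \<open>g\<close> and the average of \<open>g\<close> over its cell differ by at most
  \<open>e\<close>.\<close>

lemma step_avg_uniform_limit:
  fixes g :: "real \<Rightarrow> real"
  assumes g: "continuous_on UNIV g" "integrable unit_leb g" and "0 < e"
  shows "\<forall>\<^sub>F n in sequentially. \<forall>s\<in>{0..<1}. \<bar>step n (avg n g) s - g s\<bar> \<le> e"
proof -
  have "uniformly_continuous_on {0..1} g"
    using g continuous_on_subset by (blast intro: compact_uniformly_continuous)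
  then obtain d where d: "0 < d" "\<And>s t. s \<in> {0..1} \<Longrightarrow> t \<in> {0..1} \<Longrightarrow> \<bar>t - s\<bar> < d \<Longrightarrow> \<bar>g t - g s\<bar> < e"
    using \<open>0 < e\<close> unfolding uniformly_continuous_on_def dist_real_def by metis
  have "(\<lambda>n. (1 / 2) ^ n :: real) \<longlonglongrightarrow> 0"
    by (rule LIMSEQ_power_zero) simp
  then have "\<forall>\<^sub>F n in sequentially. (1 / 2) ^ n < d"
    using d(1) by (rule order_tendstoD)
  then show ?thesis
  proof (eventually_elim, intro ballI)
    fix n and s :: real assume n: "(1 / 2) ^ n < d" and s: "s \<in> {0..<1}"
    define j where "j = nat \<lfloor>2 ^ n * s\<rfloor>"
    have j: "j < 2 ^ n" "s \<in> cell n j"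
      using s index_less by (auto simp: j_def mem_cell_iff)
    have aux: "2 ^ n * b - c = 2 ^ n * a" if "a = b - c / 2 ^ n" for a b c :: real
      using that by (simp add: field_simps)
    have le: "\<bar>indicator (cell n j) t * (g t - g s)\<bar> \<le> indicator (cell n j) t * e" for t
    proof (cases "t \<in> cell n j")
      case True
      then have "\<bar>t - s\<bar> < (1 / 2) ^ n"
        using j(2) by (auto simp: cell_def abs_less_iff power_divide add_divide_distrib)
      then have "\<bar>g t - g s\<bar> < e"
        using True cell_subset[OF j(1)] s n by (intro d(2)) auto
      then show ?thesis
        using True by simp
    qed simp
    have int: "integrable unit_leb (\<lambda>t. indicator (cell n j) t * (g t - g s))"
      "integrable unit_leb (\<lambda>t. indicator (cell n j) t * g t)"
      "integrable unit_leb (\<lambda>t. indicator (cell n j) t * c)" for c :: real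
      by (intro integrable_indicator_cell g(2) Bochner_Integration.integrable_diff integrable_const_unit)+
    have "(\<integral>t. indicator (cell n j) t * (g t - g s) \<partial>unit_leb) =
        (\<integral>t. indicator (cell n j) t * g t \<partial>unit_leb) - g s / 2 ^ n"
      unfolding right_diff_distrib
      by (subst Bochner_Integration.integral_diff[OF int(2,3)]) (simp only: integral_indicator_cell[OF j(1)])
    then have "avg n g j - g s = 2 ^ n * (\<integral>t. indicator (cell n j) t * (g t - g s) \<partial>unit_leb)"
      unfolding avg_def by (rule aux)
    also have "\<bar>\<dots>\<bar> \<le> 2 ^ n * (\<integral>t. indicator (cell n j) t * e \<partial>unit_leb)"
      unfolding abs_mult power_abs abs_numeral
    proof (intro mult_left_mono)
      have "\<bar>\<integral>t. indicator (cell n j) t * (g t - g s) \<partial>unit_leb\<bar> \<le>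
          (\<integral>t. \<bar>indicator (cell n j) t * (g t - g s)\<bar> \<partial>unit_leb)"
        by (rule integral_abs_bound)
      also have "\<dots> \<le> (\<integral>t. indicator (cell n j) t * e \<partial>unit_leb)"
        using int le by (intro integral_mono) auto
      finally show "\<bar>\<integral>t. indicator (cell n j) t * (g t - g s) \<partial>unit_leb\<bar> \<le> (\<integral>t. indicator (cell n j) t * e \<partial>unit_leb)" .
    qed simp
    also have "\<dots> = e"
      unfolding integral_indicator_cell[OF j(1)] by simp
    finally show "\<bar>step n (avg n g) s - g s\<bar> \<le> e"
      by (simp add: step_def j_def)
  qed
qed

text \<open>Approximation by a continuous \<open>g\<close> leaves three errors: the averages of
  \<open>f - g\<close>, controlled by contraction, \<open>f - g\<close> itself, and the uniform
  error for \<open>g\<close>. Each is at most \<open>e / 4\<close>.\<close>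

lemma step_avg_L1_limit:
  assumes f: "integrable unit_leb f"
  shows "(\<lambda>n. \<integral>s. \<bar>step n (avg n f) s - f s\<bar> \<partial>unit_leb) \<longlonglongrightarrow> 0"
proof (rule tendstoI)
  fix e :: real assume "0 < e"
  then obtain g where g: "continuous_on UNIV g" "(\<integral>s. \<bar>f s - g s\<bar> \<partial>unit_leb) < e / 4"
    using L1_dense_continuous[OF f, of "e / 4"] by auto
  have "compact (g ` {0..1})"
    using g(1) by (intro compact_continuous_image) (auto intro: continuous_on_subset)
  then obtain b where b: "\<And>s. s \<in> {0..1} \<Longrightarrow> \<bar>g s\<bar> \<le> b"
    by (metis compact_imp_bounded bounded_iff imageI real_norm_def)
  have "g \<in> borel_measurable unit_leb"
    using g(1) by (intro measurable_restrict_space1 measurable_completion) (auto intro: borel_measurable_continuous_onI)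
  then have ig: "integrable unit_leb g"
    using b by (intro finite_measure.integrable_const_bound[OF finite_measure_unit_leb, of _ b])
      (auto simp: space_restrict_space intro!: AE_I2)
  have fg: "integrable unit_leb (\<lambda>s. f s - g s)"
    using f ig by simp
  have "\<forall>\<^sub>F n in sequentially. \<forall>s\<in>{0..<1}. \<bar>step n (avg n g) s - g s\<bar> \<le> e / 4"
    using step_avg_uniform_limit[OF g(1) ig, of "e / 4"] \<open>0 < e\<close> by simp
  then show "\<forall>\<^sub>F n in sequentially. dist (\<integral>s. \<bar>step n (avg n f) s - f s\<bar> \<partial>unit_leb) 0 < e"
  proof eventually_elim
    fix n assume n: "\<forall>s\<in>{0..<1}. \<bar>step n (avg n g) s - g s\<bar> \<le> e / 4"
    have "avg n f j = avg n (\<lambda>s. f s - g s) j + avg n g j" for j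
      using avg_combination[OF fg ig, of n 1 j] by simp
    then have split: "step n (avg n f) s = step n (avg n (\<lambda>s. f s - g s)) s + step n (avg n g) s" for s
      by (simp add: step_def)
    have "(\<integral>s. \<bar>step n (avg n f) s - f s\<bar> \<partial>unit_leb) \<le>
        (\<integral>s. (\<bar>step n (avg n (\<lambda>s. f s - g s)) s\<bar> + \<bar>f s - g s\<bar>) + e / 4 \<partial>unit_leb)"
    proof (intro integral_mono)
      fix s assume "s \<in> space unit_leb"
      then have "\<bar>step n (avg n g) s - g s\<bar> \<le> e / 4"
        using n by (simp add: space_restrict_space)
      then show "\<bar>step n (avg n f) s - f s\<bar> \<le> \<bar>step n (avg n (\<lambda>s. f s - g s)) s\<bar> + \<bar>f s - g s\<bar> + e / 4"
        unfolding split by linarith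
    qed (use f fg integrable_step in auto)
    also have "\<dots> = (\<integral>s. \<bar>step n (avg n (\<lambda>s. f s - g s)) s\<bar> \<partial>unit_leb) + (\<integral>s. \<bar>f s - g s\<bar> \<partial>unit_leb) + e / 4"
      using fg integrable_step by (simp add: measure_unit_leb)
    also have "\<dots> < e"
      using integral_abs_step_avg_le[OF fg, of n] g(2) \<open>0 < e\<close> by linarith
    finally show "dist (\<integral>s. \<bar>step n (avg n f) s - f s\<bar> \<partial>unit_leb) 0 < e"
      by simp
  qed
qed

lemma conv_step_avg: "integrable unit_leb f \<Longrightarrow> conv_AE_subseq (\<lambda>n. step n (avg n f)) f"
  by (intro conv_AE_subseq_L1 integrable_step step_avg_L1_limit)

lemma abs_avg_le_integral:
  assumes f: "integrable unit_leb f"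
  shows "\<bar>avg n f j\<bar> \<le> 2 ^ n * (\<integral>s. \<bar>f s\<bar> \<partial>unit_leb)"
proof -
  have "avg n (\<lambda>s. \<bar>f s\<bar>) j \<le> 2 ^ n * (\<integral>s. \<bar>f s\<bar> \<partial>unit_leb)"
    unfolding avg_def using f
    by (intro mult_left_mono integral_mono integrable_indicator_cell) (auto simp: indicator_def)
  then show ?thesis
    using abs_avg_le[OF f] order_trans by blast
qed

text \<open>The levels \<open>m i\<close> are left open because each coordinate will own its own
  infinite set of levels; \<open>i \<le> m i\<close> only expresses that they tend to
  infinity.\<close>

theorem ex_L1_limit_projection:
  obtains P where "blin (seq_gauge L1_gauge) L1_gauge P"
    "\<And>f m. integrable unit_leb f \<Longrightarrow> (\<And>i. i \<le> m i) \<Longrightarrow>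
      eqv L1_gauge (P (\<lambda>i. step (m i) (avg (m i) f))) f"
proof -
  obtain U :: "nat filter" where U: "U \<noteq> bot" "U \<le> sequentially"
    and U_lim: "\<And>x::nat \<Rightarrow> real. Bseq x \<Longrightarrow> \<exists>l. (x \<longlongrightarrow> l) U"
    using ex_limit_filter by blast
  let ?X = "seq_gauge L1_gauge"
  \<comment> \<open>For each \<open>F\<close>, these are the values of the limiting martingale on
    the cells. \<open>Lim\<close> is meaningful for bounded \<open>F\<close>, where the averages
    over a fixed cell form a bounded sequence.\<close>
  define w where "w F n j = Lim U (\<lambda>i. avg n (F i) j)" for F :: "nat \<Rightarrow> real \<Rightarrow> real" and n j
  have w: "((\<lambda>i. avg n (F i) j) \<longlongrightarrow> w F n j) U" if "?X F C" for F C n j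
  proof -
    have "\<bar>avg n (F i) j\<bar> \<le> 2 ^ n * C" for i
    proof -
      have "integrable unit_leb (F i)" "(\<integral>s. \<bar>F i s\<bar> \<partial>unit_leb) \<le> C"
        using that by (auto simp: seq_gauge_def L1_gauge_def)
      then have "2 ^ n * (\<integral>s. \<bar>F i s\<bar> \<partial>unit_leb) \<le> 2 ^ n * C" "\<bar>avg n (F i) j\<bar> \<le> 2 ^ n * (\<integral>s. \<bar>F i s\<bar> \<partial>unit_leb)"
        by (auto intro: abs_avg_le_integral)
      then show ?thesis by linarith
    qed
    then have "Bseq (\<lambda>i. avg n (F i) j)"
      by (intro BseqI'[of _ "2 ^ n * C"]) simp
    then show ?thesis
      using U_lim U(1) tendsto_Lim unfolding w_def by blast
  qed
  have w_eq: "w F n j = l" if "?X F C" "((\<lambda>i. avg n (F i) j) \<longlongrightarrow> l) U" for F C n j l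
    using tendsto_unique[OF U(1) w[OF that(1)] that(2)] .
  have w_refine: "w F n j = (w F (Suc n) (2 * j) + w F (Suc n) (2 * j + 1)) / 2" if "?X F C" for F C n j
  proof (rule w_eq[OF that])
    have "((\<lambda>i. (avg (Suc n) (F i) (2 * j) + avg (Suc n) (F i) (2 * j + 1)) / 2) \<longlongrightarrow>
        (w F (Suc n) (2 * j) + w F (Suc n) (2 * j + 1)) / 2) U"
      by (intro tendsto_intros w[OF that]) simp
    then show "((\<lambda>i. avg n (F i) j) \<longlongrightarrow> (w F (Suc n) (2 * j) + w F (Suc n) (2 * j + 1)) / 2) U"
      using that by (simp add: seq_gauge_def L1_gauge_def avg_refine[of _ n j])
  qed
  have X_comb: "?X (c *\<^sub>R F + G) (\<bar>c\<bar> * C + D)" if "?X F C" "?X G D" for F G C D c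
    by (rule gauge_combination[OF gauge_seq[OF norm_gauge_L1], OF that])
  have w_comb: "w (c *\<^sub>R F + G) n j = c * w F n j + w G n j" if F: "?X F C" and G: "?X G D" for F G C D c n j
  proof (rule w_eq[OF X_comb[OF F G]])
    have "((\<lambda>i. c * avg n (F i) j + avg n (G i) j) \<longlongrightarrow> c * w F n j + w G n j) U"
      by (intro tendsto_intros w[OF F] w[OF G])
    then show "((\<lambda>i. avg n ((c *\<^sub>R F + G) i) j) \<longlongrightarrow> c * w F n j + w G n j) U"
      using F G by (simp add: seq_gauge_def L1_gauge_def plus_fun_def scaleR_fun_def avg_combination)
  qed
  have conv_nonneg: "\<exists>h. conv_AE_subseq (\<lambda>n. step n (w F n)) h" if F: "?X F C" "\<And>i s. 0 \<le> F i s" for F C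
  proof -
    have "0 \<le> w F n j" for n j
      by (rule tendsto_lowerbound[OF w[OF F(1)] _ U(1)]) (simp add: avg_nonneg F(2))
    then show ?thesis
      using nonneg_martingale_conv[of "w F"] w_refine[OF F(1)] by blast
  qed
  \<comment> \<open>The splitting is applied to the functions \<open>F i\<close>, not to the
    martingale: positive and negative parts of \<open>F\<close> have nonnegative limiting
    martingales, whose difference is that of \<open>F\<close>. The sign \<open>r\<close> treats both
    parts at once.\<close>
  have conv: "\<exists>h. conv_AE_subseq (\<lambda>n. step n (w F n)) h" if F: "?X F C" for F C
  proof -
    have "?X (\<lambda>i s. max 0 (r * F i s)) C" if r: "\<bar>r\<bar> = 1" for r
      unfolding seq_gauge_def L1_gauge_def
    proof (intro allI conjI)
      fix i
      have Fi: "integrable unit_leb (F i)" "(\<integral>s. \<bar>F i s\<bar> \<partial>unit_leb) \<le> C"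
        using F by (auto simp: seq_gauge_def L1_gauge_def)
      show int: "integrable unit_leb (\<lambda>s. max 0 (r * F i s))"
        using Fi by (intro integrable_max) auto
      have "(\<integral>s. \<bar>max 0 (r * F i s)\<bar> \<partial>unit_leb) \<le> (\<integral>s. \<bar>F i s\<bar> \<partial>unit_leb)"
      proof (intro integral_mono)
        fix s
        have "\<bar>r * F i s\<bar> = \<bar>F i s\<bar>"
          using r by (simp add: abs_mult)
        then show "\<bar>max 0 (r * F i s)\<bar> \<le> \<bar>F i s\<bar>"
          by linarith
      qed (use int Fi in auto)
      then show "(\<integral>s. \<bar>max 0 (r * F i s)\<bar> \<partial>unit_leb) \<le> C"
        using Fi by linarith
    qed
    from this[of 1] this[of "-1"]
    have b: "?X (\<lambda>i s. max 0 (F i s)) C" "?X (\<lambda>i s. max 0 (- F i s)) C"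
      by auto
    obtain h1 h2 where h: "conv_AE_subseq (\<lambda>n. step n (w (\<lambda>i s. max 0 (F i s)) n)) h1"
      "conv_AE_subseq (\<lambda>n. step n (w (\<lambda>i s. max 0 (- F i s)) n)) h2"
      using conv_nonneg[OF b(1)] conv_nonneg[OF b(2)] by auto
    have "(-1) *\<^sub>R (\<lambda>i s. max 0 (- F i s)) + (\<lambda>i s. max 0 (F i s)) = F"
      by (auto simp: fun_eq_iff)
    then have "w F n j = (-1) * w (\<lambda>i s. max 0 (- F i s)) n j + w (\<lambda>i s. max 0 (F i s)) n j" for n j
      using w_comb[OF b(2,1), of "-1" n j] by simp
    then have "(\<lambda>n s. (-1) * step n (w (\<lambda>i s. max 0 (- F i s)) n) s + step n (w (\<lambda>i s. max 0 (F i s)) n) s)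
        = (\<lambda>n. step n (w F n))"
      by (simp add: step_def fun_eq_iff)
    then show ?thesis
      using conv_AE_subseq_combination[OF h(2,1), of "-1"] by auto
  qed
  \<comment> \<open>Any limit in measure may be chosen: two of them agree almost everywhere, and
    this turns into linearity of \<open>P\<close> up to \<open>eqv\<close>.\<close>
  define P where "P F = (SOME h. conv_AE_subseq (\<lambda>n. step n (w F n)) h)" for F
  have P: "conv_AE_subseq (\<lambda>n. step n (w F n)) (P F)" if "?X F C" for F C
    unfolding P_def using conv[OF that] by (rule someI_ex)
  have P_bound: "L1_gauge (P F) C" if F: "?X F C" for F C
  proof -
    have "(\<integral>s. \<bar>step n (w F n) s\<bar> \<partial>unit_leb) \<le> C" for n
    proof -
      have "((\<lambda>i. \<Sum>j<2 ^ n. \<bar>avg n (F i) j\<bar>) \<longlongrightarrow> (\<Sum>j<2 ^ n. \<bar>w F n j\<bar>)) U"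
        by (intro tendsto_intros w[OF F])
      moreover have "(\<Sum>j<2 ^ n. \<bar>avg n (F i) j\<bar>) \<le> 2 ^ n * C" for i
      proof -
        have "integrable unit_leb (F i)" "(\<integral>s. \<bar>F i s\<bar> \<partial>unit_leb) \<le> C"
          using F by (auto simp: seq_gauge_def L1_gauge_def)
        then have "2 ^ n * (\<integral>s. \<bar>F i s\<bar> \<partial>unit_leb) \<le> 2 ^ n * C"
          "(\<Sum>j<2 ^ n. \<bar>avg n (F i) j\<bar>) \<le> 2 ^ n * (\<integral>s. \<bar>F i s\<bar> \<partial>unit_leb)"
          by (auto intro: sum_abs_avg_le)
        then show ?thesis by linarith
      qed
      ultimately have "(\<Sum>j<2 ^ n. \<bar>w F n j\<bar>) \<le> 2 ^ n * C"
        using U(1) by (intro tendsto_upperbound[where F = U]) auto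
      then show ?thesis
        unfolding step_compose integral_step by (simp add: field_simps)
    qed
    then show ?thesis
      unfolding L1_gauge_def using conv_AE_subseq_Fatou[OF P[OF F] integrable_step] by blast
  qed
  show thesis
  proof (rule that)
    show "blin ?X L1_gauge P"
    proof (rule blinI[of 1])
      fix c F G assume "mem ?X F" "mem ?X G"
      then obtain C D where FG: "?X F C" "?X G D"
        by (auto simp: mem_def)
      have "(\<lambda>n s. c * step n (w F n) s + step n (w G n) s) = (\<lambda>n. step n (w (c *\<^sub>R F + G) n))"
        by (simp add: step_def fun_eq_iff w_comb[OF FG])
      then have "AE s in unit_leb. P (c *\<^sub>R F + G) s = c * P F s + P G s"
        using conv_AE_subseq_unique[OF P[OF X_comb[OF FG]]]
          conv_AE_subseq_combination[OF P[OF FG(1)] P[OF FG(2)], of c] by simp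
      moreover have "integrable unit_leb (P F)" "integrable unit_leb (P G)" "integrable unit_leb (P (c *\<^sub>R F + G))"
        using P_bound FG X_comb[OF FG] unfolding L1_gauge_def by blast+
      ultimately show "eqv L1_gauge (P (c *\<^sub>R F + G)) (c *\<^sub>R P F + P G)"
        by (intro eqv_L1I) (simp_all add: plus_fun_def scaleR_fun_def)
    qed (simp_all add: P_bound)
    fix f :: "real \<Rightarrow> real" and m :: "nat \<Rightarrow> nat" assume f: "integrable unit_leb f" and m: "\<And>i. i \<le> m i"
    let ?F = "\<lambda>i. step (m i) (avg (m i) f)"
    have F: "?X ?F (\<integral>s. \<bar>f s\<bar> \<partial>unit_leb)"
      using integrable_step integral_abs_step_avg_le[OF f] by (simp add: seq_gauge_def L1_gauge_def)
    \<comment> \<open>As soon as \<open>n \<le> i\<close>, also \<open>n \<le> m i\<close>, and the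
      tower property makes the averages at level \<open>n\<close> independent of \<open>i\<close>.
      The restriction on \<open>j\<close> loses nothing on [0,1).\<close>
    have wF: "w ?F n j = avg n f j" if j: "j < 2 ^ n" for n j
    proof (rule w_eq[OF F])
      have "eventually (\<lambda>i. avg n (?F i) j = avg n f j) sequentially"
        using eventually_ge_at_top[of n]
        by eventually_elim (use m order_trans j in \<open>blast intro: avg_step_avg[OF f]\<close>)
      then show "((\<lambda>i. avg n (?F i) j) \<longlongrightarrow> avg n f j) U"
        using U(2) by (intro tendsto_eventually) (rule filter_leD)
    qed
    have eq: "step n (w ?F n) s = step n (avg n f) s" if "s \<in> space unit_leb" for n s
      using that wF index_less[of s n] by (simp add: space_restrict_space step_def)
    obtain r where r: "AE s in unit_leb. (\<lambda>k. step (id (r k)) (w ?F (id (r k))) s) \<longlonglongrightarrow> P ?F s"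
      "AE s in unit_leb. (\<lambda>k. step (id (r k)) (avg (id (r k)) f) s) \<longlonglongrightarrow> f s"
      using conv_AE_subseq_common[OF P[OF F] conv_step_avg[OF f] strict_mono_id] .
    then have "AE s in unit_leb. P ?F s = f s"
      using AE_space by eventually_elim (simp add: eq LIMSEQ_unique)
    then show "eqv L1_gauge (P ?F) f"
      using f P_bound[OF F] by (intro eqv_L1I) (simp_all add: L1_gauge_def)
  qed
qed

section \<open>The Cesaro spaces\<close>

definition ces_gauge :: "(nat \<Rightarrow> real) \<Rightarrow> real \<Rightarrow> bool" where
  "ces_gauge a c \<longleftrightarrow> (\<forall>n\<ge>1. (\<Sum>k<n. \<bar>a k\<bar>) \<le> c * real n)"

text \<open>\<open>0 \<le> c\<close> has to be demanded because \<open>ennreal\<close> sends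
  negative reals to 0, so a null function would otherwise have negative bounds. In
  \<open>ces_gauge\<close> nonnegativity follows from the inequality at
  \<open>n = 1\<close>.\<close>

definition Ces_gauge :: "(real \<Rightarrow> real) \<Rightarrow> real \<Rightarrow> bool" where
  "Ces_gauge f c \<longleftrightarrow> 0 \<le> c \<and> set_borel_measurable lebesgue {0..} f \<and>
     (\<forall>x>0. Ces_int f x \<le> ennreal (c * x))"

lemma norm_gauge_ces: "norm_gauge ces_gauge"
  unfolding norm_gauge_def
proof (intro conjI allI impI)
  show "ces_gauge 0 0"
    by (simp add: ces_gauge_def)
next
  fix a c assume "ces_gauge a c"
  then have "\<bar>a 0\<bar> \<le> c"
    unfolding ces_gauge_def by (elim allE[of _ 1]) simp
  then show "0 \<le> c" by simp
next
  fix a c d assume "ces_gauge a c" "c \<le> d"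
  then show "ces_gauge a d"
    unfolding ces_gauge_def by (meson mult_right_mono of_nat_0_le_iff order_trans)
next
  fix r a b c d assume h: "ces_gauge a c" "ces_gauge b d"
  show "ces_gauge (r *\<^sub>R a + b) (\<bar>r\<bar> * c + d)"
    unfolding ces_gauge_def
  proof (intro allI impI)
    fix n :: nat assume n: "1 \<le> n"
    have "(\<Sum>k<n. \<bar>(r *\<^sub>R a + b) k\<bar>) \<le> (\<Sum>k<n. \<bar>r\<bar> * \<bar>a k\<bar> + \<bar>b k\<bar>)"
      by (intro sum_mono) (auto simp: abs_mult[symmetric] abs_triangle_ineq)
    also have "\<dots> = \<bar>r\<bar> * (\<Sum>k<n. \<bar>a k\<bar>) + (\<Sum>k<n. \<bar>b k\<bar>)"
      by (simp add: sum.distrib sum_distrib_left)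
    also have "\<dots> \<le> \<bar>r\<bar> * (c * real n) + d * real n"
      using h n by (intro add_mono mult_left_mono) (auto simp: ces_gauge_def)
    finally show "(\<Sum>k<n. \<bar>(r *\<^sub>R a + b) k\<bar>) \<le> (\<bar>r\<bar> * c + d) * real n"
      by (simp add: algebra_simps)
  qed
qed

lemma Ces_integrand_measurable:
  fixes f :: "real \<Rightarrow> real" and x :: real
  assumes "set_borel_measurable lebesgue {0..} f"
  shows "(\<lambda>t. ennreal (indicator {0..x} t * \<bar>f t\<bar>)) \<in> borel_measurable lebesgue"
proof -
  have "(\<lambda>t. ennreal (indicator {0..x} t * \<bar>indicator {0..} t *\<^sub>R f t\<bar>)) \<in> borel_measurable lebesgue"
    using assms unfolding set_borel_measurable_def
    by (intro measurable_compose[OF _ measurable_ennreal] borel_measurable_times borel_measurable_abs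
        borel_measurable_indicator) auto
  also have "(\<lambda>t. ennreal (indicator {0..x} t * \<bar>indicator {0..} t *\<^sub>R f t\<bar>)) =
      (\<lambda>t. ennreal (indicator {0..x} t * \<bar>f t\<bar>))"
    by (auto simp: indicator_def fun_eq_iff)
  finally show ?thesis .
qed

lemma norm_gauge_Ces: "norm_gauge Ces_gauge"
  unfolding norm_gauge_def
proof (intro conjI allI impI)
  show "Ces_gauge 0 0"
    by (simp add: Ces_gauge_def Ces_int_def set_borel_measurable_def)
next
  fix f c d assume h: "Ces_gauge f c" "c \<le> d"
  then have "ennreal (c * x) \<le> ennreal (d * x)" if "0 < x" for x
    using that by (intro ennreal_leI mult_right_mono) auto
  then show "Ces_gauge f d"
    using h unfolding Ces_gauge_def by (auto intro: order_trans)
next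
  fix r f g c d assume h: "Ces_gauge f c" "Ces_gauge g d"
  then have m: "set_borel_measurable lebesgue {0..} f" "set_borel_measurable lebesgue {0..} g"
    and nn: "0 \<le> c" "0 \<le> d"
    by (auto simp: Ces_gauge_def)
  have "set_borel_measurable lebesgue {0..} (r *\<^sub>R f + g)"
  proof -
    have "(\<lambda>t. r * (indicator {0..} t *\<^sub>R f t) + indicator {0..} t *\<^sub>R g t) \<in> borel_measurable lebesgue"
      using m unfolding set_borel_measurable_def by measurable
    then show ?thesis
      unfolding set_borel_measurable_def by (simp add: algebra_simps)
  qed
  moreover have "Ces_int (r *\<^sub>R f + g) x \<le> ennreal ((\<bar>r\<bar> * c + d) * x)" if "0 < x" for x
  proof -
    have "Ces_int (r *\<^sub>R f + g) x \<le> (\<integral>\<^sup>+ t. ennreal \<bar>r\<bar> * ennreal (indicator {0..x} t * \<bar>f t\<bar>) +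
        ennreal (indicator {0..x} t * \<bar>g t\<bar>) \<partial>lebesgue)"
      unfolding Ces_int_def
    proof (intro nn_integral_mono)
      fix t
      have "indicator {0..x} t * \<bar>(r *\<^sub>R f + g) t\<bar> \<le> indicator {0..x} t * (\<bar>r\<bar> * \<bar>f t\<bar> + \<bar>g t\<bar>)"
        by (intro mult_left_mono) (auto simp: abs_mult[symmetric] abs_triangle_ineq)
      also have "\<dots> = \<bar>r\<bar> * (indicator {0..x} t * \<bar>f t\<bar>) + indicator {0..x} t * \<bar>g t\<bar>"
        by (simp add: algebra_simps)
      finally show "ennreal (indicator {0..x} t * \<bar>(r *\<^sub>R f + g) t\<bar>) \<le>
          ennreal \<bar>r\<bar> * ennreal (indicator {0..x} t * \<bar>f t\<bar>) + ennreal (indicator {0..x} t * \<bar>g t\<bar>)"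
        by (simp add: ennreal_leI flip: ennreal_mult ennreal_plus)
    qed
    also have "\<dots> = ennreal \<bar>r\<bar> * Ces_int f x + Ces_int g x"
      unfolding Ces_int_def using Ces_integrand_measurable[OF m(1), of x] Ces_integrand_measurable[OF m(2), of x]
      by (subst nn_integral_add) (auto simp: nn_integral_cmult)
    also have "\<dots> \<le> ennreal \<bar>r\<bar> * ennreal (c * x) + ennreal (d * x)"
      using h that by (intro add_mono mult_left_mono) (auto simp: Ces_gauge_def)
    also have "\<dots> = ennreal ((\<bar>r\<bar> * c + d) * x)"
      using nn that by (simp add: distrib_right mult.assoc flip: ennreal_mult ennreal_plus)
    finally show ?thesis .
  qed
  ultimately show "Ces_gauge (r *\<^sub>R f + g) (\<bar>r\<bar> * c + d)"
    using nn by (simp add: Ces_gauge_def)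
qed (auto simp: Ces_gauge_def)

text \<open>Sequences with all partial sums of absolute differences equal to 0 coincide. Operators
  into \<open>ces_inf\<close> are therefore linear exactly, while those into \<open>Ces_inf\<close>
  are so only almost everywhere.\<close>

lemma eqv_ces_iff: "eqv ces_gauge a b \<longleftrightarrow> a = b"
proof
  assume "eqv ces_gauge a b"
  then have "(\<Sum>k<Suc n. \<bar>a k - b k\<bar>) \<le> 0" for n
    unfolding eqv_def ces_gauge_def by (elim allE[of _ "Suc n"]) simp
  then have "\<bar>a n - b n\<bar> \<le> 0" for n
    using member_le_sum[of n "{..<Suc n}" "\<lambda>k. \<bar>a k - b k\<bar>"] by (meson abs_ge_zero finite_lessThan lessI lessThan_iff order_trans)
  then show "a = b"
    by (simp add: fun_eq_iff)
qed (simp add: eqv_refl[OF norm_gauge_ces])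

lemma eqv_CesD:
  assumes "eqv Ces_gauge f g"
  shows "Ces_eq f g"
proof -
  have m: "set_borel_measurable lebesgue {0..} (f - g)" and 0: "\<And>x. 0 < x \<Longrightarrow> Ces_int (f - g) x = 0"
    using assms by (auto simp: eqv_def Ces_gauge_def)
  have "AE t in lebesgue. ennreal (indicator {0..real (Suc n)} t * \<bar>(f - g) t\<bar>) = 0" for n
    using nn_integral_0_iff_AE[OF Ces_integrand_measurable[OF m, of "real (Suc n)"]] 0[of "real (Suc n)"]
    unfolding Ces_int_def by simp
  then have "AE t in lebesgue. \<forall>n. ennreal (indicator {0..real (Suc n)} t * \<bar>(f - g) t\<bar>) = 0"
    unfolding AE_all_countable by blast
  then show ?thesis
    unfolding Ces_eq_def
  proof eventually_elim
    fix t assume h: "\<forall>n. ennreal (indicator {0..real (Suc n)} t * \<bar>(f - g) t\<bar>) = 0"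
    show "0 \<le> t \<longrightarrow> f t = g t"
    proof
      assume t: "0 \<le> t"
      obtain n where "t \<le> real n"
        using real_arch_simple by blast
      then have "t \<le> real (Suc n)"
        by simp
      then show "f t = g t"
        using t h[rule_format, of n] by simp
    qed
  qed
qed

text \<open>The point 0 is exempt because the dyadic intervals cover only the positive
  reals.\<close>

lemma eqv_CesI:
  assumes "set_borel_measurable lebesgue {0..} f" "set_borel_measurable lebesgue {0..} g"
    and "\<And>t. 0 < t \<Longrightarrow> f t = g t"
  shows "eqv Ces_gauge f g"
proof -
  have "(\<lambda>t. indicator {0..} t *\<^sub>R f t - indicator {0..} t *\<^sub>R g t) \<in> borel_measurable lebesgue"
    using assms(1,2) unfolding set_borel_measurable_def by measurable
  then have "set_borel_measurable lebesgue {0..} (f - g)"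
    unfolding set_borel_measurable_def by (simp add: algebra_simps)
  moreover have "Ces_int (f - g) x = 0" for x
  proof -
    have "AE t in lebesgue. t \<noteq> (0::real)"
      by (rule AE_not_in[of "{0}", simplified]) (simp add: negligible_iff_null_sets[symmetric])
    then have "AE t in lebesgue. ennreal (indicator {0..x} t * \<bar>(f - g) t\<bar>) = 0"
      by eventually_elim (use assms(3) in \<open>auto simp: indicator_def\<close>)
    then have "Ces_int (f - g) x = (\<integral>\<^sup>+ t. 0 \<partial>(lebesgue :: real measure))"
      unfolding Ces_int_def by (rule nn_integral_cong_AE)
    then show ?thesis by simp
  qed
  ultimately show ?thesis
    by (simp add: eqv_def Ces_gauge_def)
qed

section \<open>\<open>Ces_inf\<close> as an l_infinity-sum of copies of L^1[0,1)\<close>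

definition dyad :: "int \<Rightarrow> real" where
  "dyad k = 2 powr real_of_int k"

lemma dyad_pos: "0 < dyad k"
  by (simp add: dyad_def)

lemma floor_log_eq_iff: "0 < t \<Longrightarrow> \<lfloor>log 2 t\<rfloor> = k \<longleftrightarrow> dyad k \<le> t \<and> t < 2 * dyad k"
proof -
  assume t: "0 < t"
  have "\<lfloor>log 2 t\<rfloor> = k \<longleftrightarrow> real_of_int k \<le> log 2 t \<and> log 2 t < real_of_int k + 1"
    by (simp add: floor_eq_iff)
  also have "\<dots> \<longleftrightarrow> dyad k \<le> t \<and> t < 2 powr (real_of_int k + 1)"
    using t by (simp add: dyad_def le_log_iff log_less_iff)
  finally show ?thesis
    by (simp add: dyad_def powr_add mult.commute)
qed

lemma lebesgue_affine_measurable_real: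
  fixes c t :: real
  assumes "c \<noteq> 0"
  shows "(\<lambda>x. t + c * x) \<in> lebesgue \<rightarrow>\<^sub>M lebesgue"
  using lebesgue_affine_measurable[where c = "\<lambda>x::real. c"] assms by simp

lemma nn_integral_dyadic_rescale:
  assumes g: "g \<in> borel_measurable lebesgue"
  shows "(\<integral>\<^sup>+ t. indicator {dyad k..<2 * dyad k} t * g t \<partial>lebesgue)
    = ennreal (dyad k) * (\<integral>\<^sup>+ s. g (dyad k * (1 + s)) \<partial>unit_leb)"
proof -
  have ind: "indicator {dyad k..<2 * dyad k} (dyad k + dyad k * s) = (indicator {0..<1} s :: ennreal)" for s
    using dyad_pos[of k] by (auto simp: indicator_def zero_le_mult_iff mult_le_0_iff)
  have "(\<integral>\<^sup>+ t. indicator {dyad k..<2 * dyad k} t * g t \<partial>lebesgue) = ennreal \<bar>dyad k\<bar> *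
      (\<integral>\<^sup>+ s. indicator {dyad k..<2 * dyad k} (dyad k + dyad k * s) * g (dyad k + dyad k * s) \<partial>lebesgue)"
    using g dyad_pos[of k]
    by (intro nn_integral_real_affine_lebesgue borel_measurable_times_ennreal borel_measurable_indicator) auto
  also have "(\<integral>\<^sup>+ s. indicator {dyad k..<2 * dyad k} (dyad k + dyad k * s) * g (dyad k + dyad k * s) \<partial>lebesgue)
      = (\<integral>\<^sup>+ s. g (dyad k + dyad k * s) \<partial>unit_leb)"
    unfolding ind by (subst nn_integral_restrict_space) (auto simp: mult.commute)
  finally show ?thesis
    using dyad_pos[of k] by (simp add: distrib_left)
qed

text \<open>Only the variable is rescaled, not the values: the integral of a piece over [0,1) is the
  mean of \<open>f\<close> over its dyadic interval, the quantity that the Cesaro norm controls.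
  \<open>int_decode\<close> lists the integers as a sequence.\<close>

definition Ces_pieces :: "(real \<Rightarrow> real) \<Rightarrow> nat \<Rightarrow> real \<Rightarrow> real" where
  "Ces_pieces f n s = f (dyad (int_decode n) * (1 + s))"

definition Ces_glue :: "(nat \<Rightarrow> real \<Rightarrow> real) \<Rightarrow> real \<Rightarrow> real" where
  "Ces_glue F t = (if t \<le> 0 then 0
     else F (int_encode \<lfloor>log 2 t\<rfloor>) (t / dyad \<lfloor>log 2 t\<rfloor> - 1))"

lemma Ces_glue_rescale:
  assumes "0 \<le> s" "s < 1"
  shows "Ces_glue F (dyad k * (1 + s)) = F (int_encode k) s"
proof -
  have pos: "0 < dyad k * (1 + s)"
    using assms dyad_pos[of k] by simp
  have "\<lfloor>log 2 (dyad k * (1 + s))\<rfloor> = k"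
    using assms dyad_pos[of k] by (subst floor_log_eq_iff[OF pos]) auto
  then show ?thesis
    using pos dyad_pos[of k] by (simp add: Ces_glue_def)
qed

lemma Ces_glue_pieces: "0 < t \<Longrightarrow> Ces_glue (Ces_pieces f) t = f t"
  using dyad_pos[of "\<lfloor>log 2 t\<rfloor>"] by (simp add: Ces_glue_def Ces_pieces_def)

text \<open>The mean of |f| over [d, 2d) is at most 1/d times its integral over [0, 2d], which is at
  most 2cd.\<close>

lemma L1_gauge_Ces_pieces:
  assumes f: "Ces_gauge f c"
  shows "L1_gauge (Ces_pieces f n) (2 * c)"
proof -
  let ?k = "int_decode n"
  \<comment> \<open>\<open>f\<close> is known to be measurable on [0,\<infinity>) only; extending it
    by 0 permits a change of variables on the whole line.\<close>
  define f' where "f' t = indicator {0..} t *\<^sub>R f t" for t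
  have f' [measurable]: "f' \<in> borel_measurable lebesgue" and c: "0 \<le> c"
    using f unfolding Ces_gauge_def set_borel_measurable_def f'_def by auto
  have eq: "Ces_pieces f n s = f' (dyad ?k + dyad ?k * s)" if "s \<in> {0..<1}" for s
    using that dyad_pos[of ?k] by (simp add: Ces_pieces_def f'_def distrib_left)
  have "(\<lambda>s. f' (dyad ?k + dyad ?k * s)) \<in> borel_measurable unit_leb"
    using dyad_pos[of ?k]
    by (intro measurable_restrict_space1 measurable_compose[OF lebesgue_affine_measurable_real f']) simp
  then have m [measurable]: "Ces_pieces f n \<in> borel_measurable unit_leb"
    by (subst measurable_cong[where g = "\<lambda>s. f' (dyad ?k + dyad ?k * s)"])
      (auto simp: eq space_restrict_space)
  have m': "(\<lambda>t. ennreal \<bar>f' t\<bar>) \<in> borel_measurable lebesgue"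
    by measurable
  have "ennreal (dyad ?k) * (\<integral>\<^sup>+ s. ennreal \<bar>Ces_pieces f n s\<bar> \<partial>unit_leb) =
      ennreal (dyad ?k) * (\<integral>\<^sup>+ s. ennreal \<bar>f' (dyad ?k * (1 + s))\<bar> \<partial>unit_leb)"
    by (intro arg_cong2[where f = times] nn_integral_cong refl)
      (auto simp: eq space_restrict_space distrib_left)
  also have "\<dots> = (\<integral>\<^sup>+ t. indicator {dyad ?k..<2 * dyad ?k} t * ennreal \<bar>f' t\<bar> \<partial>lebesgue)"
    by (rule nn_integral_dyadic_rescale[OF m', symmetric])
  also have "\<dots> \<le> Ces_int f (2 * dyad ?k)"
    unfolding Ces_int_def using dyad_pos[of ?k]
    by (intro nn_integral_mono) (auto simp: indicator_def f'_def)
  also have "\<dots> \<le> ennreal (c * (2 * dyad ?k))"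
    using f dyad_pos[of ?k] by (simp add: Ces_gauge_def)
  also have "\<dots> = ennreal (dyad ?k) * ennreal (2 * c)"
    using dyad_pos[of ?k] c by (simp add: ennreal_mult[symmetric] mult_ac)
  finally have le: "(\<integral>\<^sup>+ s. ennreal \<bar>Ces_pieces f n s\<bar> \<partial>unit_leb) \<le> ennreal (2 * c)"
    using dyad_pos[of ?k] by (subst (asm) ennreal_mult_le_mult_iff) auto
  then have int: "integrable unit_leb (Ces_pieces f n)"
    by (intro integrableI_bounded m) (auto intro: le_less_trans)
  have "(\<integral>s. \<bar>Ces_pieces f n s\<bar> \<partial>unit_leb) \<le> 2 * c"
    using le int c by (subst (asm) nn_integral_eq_integral) auto
  with int show ?thesis
    by (simp add: L1_gauge_def)
qed

lemma Ces_glue_measurable: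
  assumes F: "\<And>n. integrable unit_leb (F n)"
  shows "Ces_glue F \<in> borel_measurable lebesgue"
proof -
  define F' where "F' n s = indicator {0..<1} s * F n s" for n s
  have F' [measurable]: "F' n \<in> borel_measurable lebesgue" for n
    using F[of n, THEN borel_measurable_integrable]
    by (subst (asm) borel_measurable_restrict_space_iff) (auto simp: F'_def[abs_def])
  have "(\<lambda>t. F' (int_encode k) (- 1 + (1 / dyad k) * t)) \<in> borel_measurable lebesgue" for k
    using dyad_pos[of k] by (intro measurable_compose[OF lebesgue_affine_measurable_real F']) simp
  moreover have "(\<lambda>t::real. \<lfloor>log 2 t\<rfloor>) \<in> lebesgue \<rightarrow>\<^sub>M count_space UNIV"
    by (intro measurable_completion) measurable
  ultimately have "(\<lambda>t. F' (int_encode \<lfloor>log 2 t\<rfloor>) (- 1 + (1 / dyad \<lfloor>log 2 t\<rfloor>) * t)) \<in> borel_measurable lebesgue"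
    by (rule measurable_compose_countable'[where I = UNIV]) auto
  then have "(\<lambda>t. indicator {0<..} t * F' (int_encode \<lfloor>log 2 t\<rfloor>) (- 1 + (1 / dyad \<lfloor>log 2 t\<rfloor>) * t))
      \<in> borel_measurable lebesgue"
    by (intro borel_measurable_times borel_measurable_indicator) auto
  also have "(\<lambda>t. indicator {0<..} t * F' (int_encode \<lfloor>log 2 t\<rfloor>) (- 1 + (1 / dyad \<lfloor>log 2 t\<rfloor>) * t)) = Ces_glue F"
  proof
    fix t :: real
    show "indicator {0<..} t * F' (int_encode \<lfloor>log 2 t\<rfloor>) (- 1 + (1 / dyad \<lfloor>log 2 t\<rfloor>) * t) = Ces_glue F t"
    proof (cases "0 < t")
      case True
      then have "t / dyad \<lfloor>log 2 t\<rfloor> - 1 \<in> {0..<1}"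
        using floor_log_eq_iff[OF True, of "\<lfloor>log 2 t\<rfloor>"] dyad_pos[of "\<lfloor>log 2 t\<rfloor>"] by (simp add: field_simps)
      then show ?thesis
        using True by (simp add: Ces_glue_def F'_def)
    qed (simp add: Ces_glue_def)
  qed
  finally show ?thesis .
qed

text \<open>Let K be the index of the dyadic interval containing x. The interval with index K - j
  contributes at most c 2^(K-j), so the geometric series gives 2c 2^K, which is at most 2cx.\<close>

lemma Ces_gauge_glue:
  assumes F: "\<And>n. L1_gauge (F n) c"
  shows "Ces_gauge (Ces_glue F) (2 * c)"
proof -
  have c: "0 \<le> c"
    using F gauge_nonneg[OF norm_gauge_L1] by blast
  have int: "integrable unit_leb (F n)" "(\<integral>s. \<bar>F n s\<bar> \<partial>unit_leb) \<le> c" for n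
    using F by (auto simp: L1_gauge_def)
  have m [measurable]: "Ces_glue F \<in> borel_measurable lebesgue"
    using int by (intro Ces_glue_measurable)
  then have "set_borel_measurable lebesgue {0..} (Ces_glue F)"
    unfolding set_borel_measurable_def by (intro borel_measurable_scaleR borel_measurable_indicator) auto
  moreover have "Ces_int (Ces_glue F) x \<le> ennreal (2 * c * x)" if x: "0 < x" for x
  proof -
    define K where "K = \<lfloor>log 2 x\<rfloor>"
    have dyadK: "dyad K \<le> x"
      using floor_log_eq_iff[OF x, of K] by (simp add: K_def)
    have dyad_diff: "dyad (K - int j) = dyad K * (1 / 2) ^ j" for j
      by (simp add: dyad_def powr_diff powr_realpow power_divide)
    \<comment> \<open>The interval for j = 0 may extend beyond x; its whole integral is still within
      the bound.\<close>
    let ?piece = "\<lambda>j t. indicator {dyad (K - int j)..<2 * dyad (K - int j)} t * ennreal \<bar>Ces_glue F t\<bar>"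
    have m': "(\<lambda>t. ennreal \<bar>Ces_glue F t\<bar>) \<in> borel_measurable lebesgue"
      by measurable
    have "Ces_int (Ces_glue F) x \<le> (\<integral>\<^sup>+ t. (\<Sum>j. ?piece j t) \<partial>lebesgue)"
      unfolding Ces_int_def
    proof (intro nn_integral_mono)
      fix t
      show "ennreal (indicator {0..x} t * \<bar>Ces_glue F t\<bar>) \<le> (\<Sum>j. ?piece j t)"
      proof (cases "0 < t \<and> t \<le> x")
        case True
        define k where "k = \<lfloor>log 2 t\<rfloor>"
        have "k \<le> K"
          unfolding k_def K_def using True by (intro floor_mono) (simp add: log_le_cancel_iff)
        then have k: "K - int (nat (K - k)) = k"
          by simp
        have "dyad k \<le> t" "t < 2 * dyad k"
          using True floor_log_eq_iff[of t k] by (auto simp: k_def)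
        then have "ennreal (indicator {0..x} t * \<bar>Ces_glue F t\<bar>) = ?piece (nat (K - k)) t"
          using True unfolding k by simp
        also have "\<dots> \<le> (\<Sum>j. ?piece j t)"
          using sum_le_suminf[of "\<lambda>j. ?piece j t" "{nat (K - k)}"] by (simp add: summableI)
        finally show ?thesis .
      next
        case False
        then have "indicator {0..x} t * \<bar>Ces_glue F t\<bar> = 0"
          by (auto simp: Ces_glue_def indicator_def)
        then show ?thesis
          by (simp only: ennreal_0 zero_le)
      qed
    qed
    also have "\<dots> = (\<Sum>j. \<integral>\<^sup>+ t. ?piece j t \<partial>lebesgue)"
      by (intro nn_integral_suminf borel_measurable_times_ennreal borel_measurable_indicator m') simp
    also have "\<dots> \<le> (\<Sum>j. ennreal (dyad K * c * (1 / 2) ^ j))"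
    proof (intro suminf_le summableI)
      fix j
      let ?k = "K - int j"
      have "(\<integral>\<^sup>+ t. ?piece j t \<partial>lebesgue) = ennreal (dyad ?k) * (\<integral>\<^sup>+ s. ennreal \<bar>Ces_glue F (dyad ?k * (1 + s))\<bar> \<partial>unit_leb)"
        by (rule nn_integral_dyadic_rescale[OF m'])
      also have "(\<integral>\<^sup>+ s. ennreal \<bar>Ces_glue F (dyad ?k * (1 + s))\<bar> \<partial>unit_leb) =
          (\<integral>\<^sup>+ s. ennreal \<bar>F (int_encode ?k) s\<bar> \<partial>unit_leb)"
        by (intro nn_integral_cong) (auto simp: Ces_glue_rescale space_restrict_space)
      also have "\<dots> = ennreal (\<integral>s. \<bar>F (int_encode ?k) s\<bar> \<partial>unit_leb)"
        using int by (intro nn_integral_eq_integral) auto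
      also have "ennreal (dyad ?k) * \<dots> \<le> ennreal (dyad ?k) * ennreal c"
        by (intro mult_left_mono ennreal_leI int) simp
      also have "\<dots> = ennreal (dyad K * c * (1 / 2) ^ j)"
        using dyad_pos[of ?k] c unfolding dyad_diff by (simp add: ennreal_mult[symmetric] mult_ac)
      finally show "(\<integral>\<^sup>+ t. ?piece j t \<partial>lebesgue) \<le> ennreal (dyad K * c * (1 / 2) ^ j)" .
    qed
    also have "\<dots> = ennreal (dyad K * c * 2)"
    proof (rule suminf_ennreal_eq)
      show "(\<lambda>j. dyad K * c * (1 / 2) ^ j) sums (dyad K * c * 2)"
        using sums_mult[OF geometric_sums[of "1 / 2 :: real"], of "dyad K * c"] by simp
    qed (use dyad_pos[of K] c in simp)
    also have "\<dots> \<le> ennreal (2 * c * x)"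
      using mult_left_mono[OF dyadK, of "2 * c"] c by (intro ennreal_leI) (simp add: mult_ac)
    finally show ?thesis .
  qed
  ultimately show ?thesis
    using c by (simp add: Ces_gauge_def)
qed

lemma isomorphic_Ces_seq_L1: "isomorphic Ces_gauge (seq_gauge L1_gauge)"
  unfolding isomorphic_def
proof (intro exI conjI allI impI)
  show T: "blin Ces_gauge (seq_gauge L1_gauge) Ces_pieces"
  proof (rule blinI[of 2])
    fix r f g
    have "Ces_pieces (r *\<^sub>R f + g) = r *\<^sub>R Ces_pieces f + Ces_pieces g"
      by (simp add: Ces_pieces_def fun_eq_iff)
    then show "eqv (seq_gauge L1_gauge) (Ces_pieces (r *\<^sub>R f + g)) (r *\<^sub>R Ces_pieces f + Ces_pieces g)"
      using eqv_refl[OF gauge_seq[OF norm_gauge_L1]] by simp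
  qed (auto simp: seq_gauge_def L1_gauge_Ces_pieces)
  show S: "blin (seq_gauge L1_gauge) Ces_gauge Ces_glue"
  proof (rule blinI[of 2])
    fix r F G
    have "Ces_glue (r *\<^sub>R F + G) = r *\<^sub>R Ces_glue F + Ces_glue G"
      by (simp add: Ces_glue_def fun_eq_iff)
    then show "eqv Ces_gauge (Ces_glue (r *\<^sub>R F + G)) (r *\<^sub>R Ces_glue F + Ces_glue G)"
      using eqv_refl[OF norm_gauge_Ces] by simp
  qed (auto simp: seq_gauge_def Ces_gauge_glue)
  show "eqv Ces_gauge (Ces_glue (Ces_pieces f)) f" if "mem Ces_gauge f" for f
  proof (rule eqv_CesI)
    have "mem Ces_gauge (Ces_glue (Ces_pieces f))"
      by (intro blin_mem[OF S] blin_mem[OF T] that)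
    then show "set_borel_measurable lebesgue {0..} (Ces_glue (Ces_pieces f))"
      "set_borel_measurable lebesgue {0..} f"
      using that by (auto simp: mem_def Ces_gauge_def)
  qed (rule Ces_glue_pieces)
  show "eqv (seq_gauge L1_gauge) (Ces_pieces (Ces_glue F)) F" if "mem (seq_gauge L1_gauge) F" for F
    unfolding eqv_seq_iff
  proof
    fix n
    have "mem (seq_gauge L1_gauge) (Ces_pieces (Ces_glue F))"
      by (intro blin_mem[OF S] blin_mem[OF T] that)
    then have "integrable unit_leb (Ces_pieces (Ces_glue F) n)" "integrable unit_leb (F n)"
      using that by (auto simp: mem_def seq_gauge_def L1_gauge_def)
    then show "eqv L1_gauge (Ces_pieces (Ces_glue F) n) (F n)"
      by (rule eqv_L1I) (auto simp: Ces_pieces_def Ces_glue_rescale space_restrict_space intro!: AE_I2)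
  qed
qed

section \<open>\<open>ces_inf\<close> in dyadic blocks\<close>

text \<open>With the index shifted by one, the block \<open>2\<^sup>n \<le> k < 2\<^sup>n\<^sup>+\<^sup>1\<close> consists of the indices
  \<open>2 ^ n - 1 + j\<close> with \<open>j < 2 ^ n\<close>.\<close>

definition ces_blocks :: "(nat \<Rightarrow> real) \<Rightarrow> nat \<Rightarrow> real \<Rightarrow> real" where
  "ces_blocks a n = step n (\<lambda>j. a (2 ^ n - 1 + j))"

definition ces_averages :: "(nat \<Rightarrow> real \<Rightarrow> real) \<Rightarrow> nat \<Rightarrow> real" where
  "ces_averages F k = (let n = floor_log (Suc k) in avg n (F n) (Suc k - 2 ^ n))"

lemma floor_log_block: "j < 2 ^ n \<Longrightarrow> floor_log (2 ^ n + j) = n"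
  by (rule floor_log_eqI) auto

lemma ces_averages_block:
  assumes "j < 2 ^ n"
  shows "ces_averages F (2 ^ n - 1 + j) = avg n (F n) j"
proof -
  have "Suc (2 ^ n - 1 + j) = 2 ^ n + j"
    by simp
  then show ?thesis
    unfolding ces_averages_def by (simp add: floor_log_block[OF assms])
qed

lemma block_index:
  fixes k :: nat
  obtains n j where "k = 2 ^ n - 1 + j" "j < 2 ^ n"
proof
  let ?n = "floor_log (Suc k)"
  have "2 ^ ?n \<le> Suc k" "Suc k < 2 * 2 ^ ?n"
    using floor_log_exp2_le[of "Suc k"] floor_log_exp2_gt[of "Suc k"] by auto
  moreover have "(1::nat) \<le> 2 ^ ?n"
    by simp
  ultimately show "k = 2 ^ ?n - 1 + (Suc k - 2 ^ ?n)" "Suc k - 2 ^ ?n < 2 ^ ?n"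
    by linarith+
qed

text \<open>The indices below 2^m - 1 fill exactly the blocks 0, ..., m - 1.\<close>

lemma blocks_sum_le:
  fixes b :: "nat \<Rightarrow> real"
  assumes "\<And>n. (\<Sum>j<2 ^ n. b (2 ^ n - 1 + j)) \<le> 2 ^ n * c"
  shows "(\<Sum>k<2 ^ m - 1. b k) \<le> (2 ^ m - 1) * c"
proof (induction m)
  case (Suc m)
  have split: "(\<Sum>k<p + q. b k) = (\<Sum>k<p. b k) + (\<Sum>j<q. b (p + j))" for p q
    by (induction q) auto
  have eq: "(2::nat) ^ Suc m - 1 = (2 ^ m - 1) + 2 ^ m"
    by simp
  have "(\<Sum>k<2 ^ Suc m - 1. b k) = (\<Sum>k<2 ^ m - 1. b k) + (\<Sum>j<2 ^ m. b (2 ^ m - 1 + j))"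
    unfolding eq by (rule split)
  also have "\<dots> \<le> (2 ^ m - 1) * c + 2 ^ m * c"
    using Suc assms by (intro add_mono)
  finally show ?case
    by (simp add: algebra_simps)
qed simp

text \<open>Enlarge the range of summation to the end of the block in which it stops. With 2^m the
  least power of two above N, this at most doubles the length, whence the factor 2.\<close>

lemma ces_gauge_averages:
  assumes F: "\<And>n. L1_gauge (F n) c"
  shows "ces_gauge (ces_averages F) (2 * c)"
  unfolding ces_gauge_def
proof (intro allI impI)
  fix N :: nat assume N: "1 \<le> N"
  have c: "0 \<le> c"
    using F gauge_nonneg[OF norm_gauge_L1] by blast
  define m where "m = Suc (floor_log N)"
  have m: "N \<le> 2 ^ m - 1" "2 ^ m \<le> 2 * N"
    using floor_log_exp2_gt[of N] floor_log_exp2_le[of N] N by (auto simp: m_def)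
  have "(\<Sum>j<2 ^ n. \<bar>ces_averages F (2 ^ n - 1 + j)\<bar>) \<le> 2 ^ n * c" for n
  proof -
    have "(\<Sum>j<2 ^ n. \<bar>ces_averages F (2 ^ n - 1 + j)\<bar>) = (\<Sum>j<2 ^ n. \<bar>avg n (F n) j\<bar>)"
      by (intro sum.cong refl) (simp only: ces_averages_block lessThan_iff)
    also have "\<dots> \<le> 2 ^ n * (\<integral>s. \<bar>F n s\<bar> \<partial>unit_leb)"
      using F by (intro sum_abs_avg_le) (simp add: L1_gauge_def)
    also have "\<dots> \<le> 2 ^ n * c"
      using F by (intro mult_left_mono) (auto simp: L1_gauge_def)
    finally show ?thesis .
  qed
  then have "(\<Sum>k<2 ^ m - 1. \<bar>ces_averages F k\<bar>) \<le> (2 ^ m - 1) * c"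
    by (rule blocks_sum_le)
  moreover have "(\<Sum>k<N. \<bar>ces_averages F k\<bar>) \<le> (\<Sum>k<2 ^ m - 1. \<bar>ces_averages F k\<bar>)"
    using m(1) by (intro sum_mono2) auto
  moreover have "(2 ^ m - 1) * c \<le> (2 * real N) * c"
  proof (intro mult_right_mono c)
    have "real (2 ^ m) \<le> real (2 * N)"
      using m(2) by (simp only: of_nat_le_iff)
    then show "2 ^ m - 1 \<le> 2 * real N" by simp
  qed
  ultimately show "(\<Sum>k<N. \<bar>ces_averages F k\<bar>) \<le> 2 * c * real N"
    by (simp add: mult_ac)
qed

text \<open>Block n ends before index 2 * 2^n, so its absolute sum is at most 2c 2^n; the integral
  of the step function divides this by 2^n.\<close>

lemma L1_gauge_ces_blocks:
  assumes a: "ces_gauge a c"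
  shows "L1_gauge (ces_blocks a n) (2 * c)"
proof -
  have c: "0 \<le> c"
    using gauge_nonneg[OF norm_gauge_ces, of a c] a by simp
  have "(\<Sum>j<2 ^ n. \<bar>a (2 ^ n - 1 + j)\<bar>) = (\<Sum>k\<in>(+) (2 ^ n - 1) ` {..<2 ^ n}. \<bar>a k\<bar>)"
    by (subst sum.reindex) auto
  also have "\<dots> \<le> (\<Sum>k<2 * 2 ^ n. \<bar>a k\<bar>)"
    by (intro sum_mono2) auto
  also have "\<dots> \<le> c * real (2 * 2 ^ n)"
    using a unfolding ces_gauge_def by (elim allE[of _ "2 * 2 ^ n"]) simp
  finally have "(\<Sum>j<2 ^ n. \<bar>a (2 ^ n - 1 + j)\<bar>) / 2 ^ n \<le> 2 * c"
    by (simp add: field_simps)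
  then have "(\<integral>s. \<bar>ces_blocks a n s\<bar> \<partial>unit_leb) \<le> 2 * c"
    unfolding ces_blocks_def step_compose integral_step .
  then show ?thesis
    by (simp add: L1_gauge_def ces_blocks_def integrable_step)
qed

lemma blin_ces_averages: "blin (seq_gauge L1_gauge) ces_gauge ces_averages"
proof (rule blinI[of 2])
  fix r F G assume "mem (seq_gauge L1_gauge) F" "mem (seq_gauge L1_gauge) G"
  then have "integrable unit_leb (F n)" "integrable unit_leb (G n)" for n
    by (auto simp: mem_def seq_gauge_def L1_gauge_def)
  then have "ces_averages (r *\<^sub>R F + G) = r *\<^sub>R ces_averages F + ces_averages G"
    by (simp add: ces_averages_def fun_eq_iff Let_def avg_combination plus_fun_def scaleR_fun_def)
  then show "eqv ces_gauge (ces_averages (r *\<^sub>R F + G)) (r *\<^sub>R ces_averages F + ces_averages G)"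
    by (simp add: eqv_ces_iff)
qed (auto simp: seq_gauge_def ces_gauge_averages)

lemma blin_ces_blocks: "blin ces_gauge (seq_gauge L1_gauge) ces_blocks"
proof (rule blinI[of 2])
  fix r a b
  have "ces_blocks (r *\<^sub>R a + b) = r *\<^sub>R ces_blocks a + ces_blocks b"
    by (simp add: ces_blocks_def step_def fun_eq_iff)
  then show "eqv (seq_gauge L1_gauge) (ces_blocks (r *\<^sub>R a + b)) (r *\<^sub>R ces_blocks a + ces_blocks b)"
    using eqv_refl[OF gauge_seq[OF norm_gauge_L1]] by simp
qed (auto simp: seq_gauge_def L1_gauge_ces_blocks)

lemma ces_averages_blocks: "ces_averages (ces_blocks a) = a"
proof
  fix k :: nat
  obtain n j where "k = 2 ^ n - 1 + j" "j < 2 ^ n"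
    using block_index .
  then show "ces_averages (ces_blocks a) k = a k"
    by (simp only: ces_averages_block) (simp add: ces_blocks_def avg_step)
qed

lemma retract_ces_seq_L1: "retract ces_gauge (seq_gauge L1_gauge)"
  unfolding retract_def using blin_ces_averages blin_ces_blocks
  by (auto simp: ces_averages_blocks eqv_ces_iff intro!: exI[of _ ces_blocks] exI[of _ ces_averages])

lemma ces_blocks_averages:
  "s \<in> space unit_leb \<Longrightarrow> ces_blocks (ces_averages F) n s = step n (avg n (F n)) s"
  unfolding ces_blocks_def step_def
  by (rule ces_averages_block, rule index_less) (simp_all add: space_restrict_space)

text \<open>The pairing function deals out the blocks: coordinate n of a sequence in l_infinity(L^1)
  owns the levels \<open>prod_encode (n, i)\<close>. These are at least \<open>i\<close>, as the
  projection requires.\<close>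

lemma retract_seq_L1_ces: "retract (seq_gauge L1_gauge) ces_gauge"
proof -
  obtain P where P: "blin (seq_gauge L1_gauge) L1_gauge P"
    and P_id: "\<And>f m. integrable unit_leb f \<Longrightarrow> (\<And>i. i \<le> m i) \<Longrightarrow>
      eqv L1_gauge (P (\<lambda>i. step (m i) (avg (m i) f))) f"
    using ex_L1_limit_projection by blast
  note g = norm_gauge_L1 gauge_seq[OF norm_gauge_L1] gauge_seq[OF gauge_seq[OF norm_gauge_L1]]
  \<comment> \<open>Block m receives the averages, at level m, of the coordinate that owns
    it.\<close>
  define A where "A F = ces_averages (\<lambda>m. F (fst (prod_decode m)))" for F
  define Q where "Q a n = P (\<lambda>i. ces_blocks a (prod_encode (n, i)))" for a n
  have "blin (seq_gauge L1_gauge) (seq_gauge (seq_gauge L1_gauge)) (\<lambda>G n i. G (prod_encode (n, i)))"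
    by (rule blinI[of 1]) (auto simp: seq_gauge_def eqv_seq_iff intro: eqv_refl[OF g(1)])
  then have "blin ces_gauge (seq_gauge L1_gauge) (\<lambda>a n. P (\<lambda>i. ces_blocks a (prod_encode (n, i))))"
    by (intro blin_compose[OF g(3,2) blin_seq_map[OF P]] blin_compose[OF g(2,3) _ blin_ces_blocks])
  then have Q: "blin ces_gauge (seq_gauge L1_gauge) Q"
    by (simp add: Q_def[abs_def])
  have A: "blin (seq_gauge L1_gauge) ces_gauge A"
    unfolding A_def
    by (rule blin_compose[OF g(2) norm_gauge_ces blin_ces_averages blin_seq_reindex[OF g(1)]])
  have "eqv (seq_gauge L1_gauge) (Q (A F)) F" if F: "mem (seq_gauge L1_gauge) F" for F
    unfolding eqv_seq_iff
  proof
    fix n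
    let ?m = "\<lambda>i. prod_encode (n, i)"
    let ?E = "\<lambda>i. step (?m i) (avg (?m i) (F n))"
    let ?B = "\<lambda>i. ces_blocks (A F) (?m i)"
    have Fn: "integrable unit_leb (F n)"
      using mem_seqD[OF F] by (auto simp: mem_def L1_gauge_def)
    have iB: "integrable unit_leb (?B i)" for i
      by (simp add: ces_blocks_def integrable_step)
    \<comment> \<open>Off [0,1) a block of \<open>A F\<close> may run into entries of later blocks,
      so the two step functions are identified on the unit interval only. \<open>P\<close> is then
      compared on them through \<open>blin_cong\<close>.\<close>
    have eq: "?B i s = ?E i s" if "s \<in> space unit_leb" for i s
      using ces_blocks_averages[OF that] by (simp add: A_def)
    have B: "mem (seq_gauge L1_gauge) ?B"
      using blin_mem[OF blin_ces_blocks blin_mem[OF A F]] by (auto simp: mem_def seq_gauge_def)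
    have EB: "eqv (seq_gauge L1_gauge) ?E ?B"
      unfolding eqv_seq_iff using eq by (auto intro!: eqv_L1I integrable_step iB AE_I2)
    have E: "mem (seq_gauge L1_gauge) ?E"
      using eqv_mem[OF g(2) EB B] .
    have "eqv L1_gauge (P ?B) (P ?E)"
      using blin_cong[OF g(2,1) P E eqv_sym[OF g(2) EB]] .
    moreover have "eqv L1_gauge (P ?E) (F n)"
      by (intro P_id Fn le_prod_encode_2)
    ultimately show "eqv L1_gauge (Q (A F) n) (F n)"
      unfolding Q_def by (rule eqv_trans[OF g(1)])
  qed
  then show ?thesis
    unfolding retract_def using A Q by blast
qed

lemma isomorphic_Ces_ces: "isomorphic Ces_gauge ces_gauge"
  using isomorphic_trans[OF norm_gauge_Ces gauge_seq[OF norm_gauge_L1] norm_gauge_ces isomorphic_Ces_seq_L1]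
    pelczynski_decomposition[OF norm_gauge_L1 norm_gauge_ces retract_seq_L1_ces retract_ces_seq_L1] by blast

section \<open>From bounds back to norms\<close>

lemma Ces_inf_iff_mem: "f \<in> Ces_inf \<longleftrightarrow> mem Ces_gauge f"
proof
  assume "f \<in> Ces_inf"
  then obtain C where m: "set_borel_measurable lebesgue {0..} f"
    and C: "\<And>x. 0 < x \<Longrightarrow> Ces_int f x \<le> ennreal (C * x)"
    by (auto simp: Ces_inf_def)
  \<comment> \<open>\<open>C\<close> may be negative, in which case its upper bound
    \<open>ennreal (C * x)\<close> is 0 and \<open>max 0 C\<close> serves as well.\<close>
  have "Ces_int f x \<le> ennreal (max 0 C * x)" if "0 < x" for x
    using C[OF that] that by (rule_tac order_trans) (auto intro!: ennreal_leI mult_right_mono)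
  then show "mem Ces_gauge f"
    using m by (auto simp: mem_def Ces_gauge_def intro!: exI[of _ "max 0 C"])
qed (auto simp: mem_def Ces_gauge_def Ces_inf_def)

lemma ces_inf_iff_mem: "a \<in> ces_inf \<longleftrightarrow> mem ces_gauge a"
  by (auto simp: ces_inf_def mem_def ces_gauge_def)

lemma ces_norm_le: "ces_gauge a c \<Longrightarrow> ces_norm a \<le> c"
  unfolding ces_norm_def by (rule cSUP_least) (auto simp: ces_gauge_def field_simps)

lemma Ces_norm_le:
  assumes "Ces_gauge f c"
  shows "Ces_norm f \<le> c"
  unfolding Ces_norm_def
proof (rule cSUP_least)
  fix x :: real assume x: "x \<in> {0<..}"
  then have "enn2real (Ces_int f x) \<le> c * x"
    using assms by (intro enn2real_leI) (auto simp: Ces_gauge_def)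
  then show "enn2real (Ces_int f x) / x \<le> c"
    using x by (simp add: field_simps)
qed auto

lemma ces_gauge_norm:
  assumes "mem ces_gauge a"
  shows "ces_gauge a (ces_norm a)"
  unfolding ces_gauge_def
proof (intro allI impI)
  fix n :: nat assume n: "1 \<le> n"
  obtain c where "ces_gauge a c"
    using assms by (auto simp: mem_def)
  then have "bdd_above ((\<lambda>n. (\<Sum>k<n. \<bar>a k\<bar>) / real n) ` {1..})"
    by (intro bdd_aboveI2[of _ _ c]) (auto simp: ces_gauge_def field_simps)
  then have "(\<Sum>k<n. \<bar>a k\<bar>) / real n \<le> ces_norm a"
    unfolding ces_norm_def using n by (intro cSUP_upper) auto
  then show "(\<Sum>k<n. \<bar>a k\<bar>) \<le> ces_norm a * real n"
    using n by (simp add: field_simps)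
qed

lemma Ces_gauge_norm:
  assumes "mem Ces_gauge f"
  shows "Ces_gauge f (Ces_norm f)"
proof -
  obtain c where c: "Ces_gauge f c"
    using assms by (auto simp: mem_def)
  \<comment> \<open>\<open>enn2real\<close> sends \<infinity> to 0, so a bound on the real quotients
    controls the integrals only after these are known to be finite.\<close>
  have fin: "Ces_int f x = ennreal (enn2real (Ces_int f x))" and le: "enn2real (Ces_int f x) / x \<le> c"
    if "0 < x" for x
  proof -
    have "Ces_int f x \<le> ennreal (c * x)"
      using c that by (simp add: Ces_gauge_def)
    moreover from this have "Ces_int f x < top"
      by (rule le_less_trans) simp
    ultimately show "Ces_int f x = ennreal (enn2real (Ces_int f x))" "enn2real (Ces_int f x) / x \<le> c"
      using c that by (auto simp: Ces_gauge_def field_simps intro!: enn2real_leI)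
  qed
  then have "bdd_above ((\<lambda>x. enn2real (Ces_int f x) / x) ` {0<..})"
    by (intro bdd_aboveI2[of _ _ c]) auto
  then have up: "enn2real (Ces_int f x) / x \<le> Ces_norm f" if "0 < x" for x
    unfolding Ces_norm_def using that by (intro cSUP_upper) auto
  have "0 \<le> Ces_norm f"
    using up[of 1] by (rule order_trans[rotated]) auto
  moreover have "Ces_int f x \<le> ennreal (Ces_norm f * x)" if "0 < x" for x
    using up[OF that] that by (subst fin[OF that]) (auto intro!: ennreal_leI simp: field_simps)
  ultimately show ?thesis
    using c by (simp add: Ces_gauge_def)
qed

theorem theorem13:
  shows "\<exists>(T :: (real \<Rightarrow> real) \<Rightarrow> (nat \<Rightarrow> real)) (S :: (nat \<Rightarrow> real) \<Rightarrow> (real \<Rightarrow> real)).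
    (\<forall>f\<in>Ces_inf. T f \<in> ces_inf) \<and>
    (\<forall>a\<in>ces_inf. S a \<in> Ces_inf) \<and>
    (\<forall>f\<in>Ces_inf. \<forall>g\<in>Ces_inf. \<forall>c::real.
        T (\<lambda>t. c * f t + g t) = (\<lambda>n. c * T f n + T g n)) \<and>
    (\<forall>a\<in>ces_inf. \<forall>b\<in>ces_inf. \<forall>c::real.
        Ces_eq (S (\<lambda>n. c * a n + b n)) (\<lambda>t. c * S a t + S b t)) \<and>
    (\<exists>C::real. \<forall>f\<in>Ces_inf. ces_norm (T f) \<le> C * Ces_norm f) \<and>
    (\<exists>C::real. \<forall>a\<in>ces_inf. Ces_norm (S a) \<le> C * ces_norm a) \<and>
    (\<forall>f\<in>Ces_inf. Ces_eq (S (T f)) f) \<and>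
    (\<forall>a\<in>ces_inf. T (S a) = a)"
proof -
  obtain T S where T: "blin Ces_gauge ces_gauge T" and S: "blin ces_gauge Ces_gauge S"
    and ST: "\<And>f. mem Ces_gauge f \<Longrightarrow> eqv Ces_gauge (S (T f)) f"
    and TS: "\<And>a. mem ces_gauge a \<Longrightarrow> eqv ces_gauge (T (S a)) a"
    using isomorphic_Ces_ces unfolding isomorphic_def by blast
  obtain K L where K: "\<And>f c. Ces_gauge f c \<Longrightarrow> ces_gauge (T f) (K * c)"
    and L: "\<And>a c. ces_gauge a c \<Longrightarrow> Ces_gauge (S a) (L * c)"
    using blin_boundE[OF T] blin_boundE[OF S] by metis
  have linT: "T (\<lambda>t. c * f t + g t) = (\<lambda>n. c * T f n + T g n)"
    if "mem Ces_gauge f" "mem Ces_gauge g" for f g c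
    using blin_combination[OF T that, of c] by (simp add: eqv_ces_iff plus_fun_def scaleR_fun_def)
  have linS: "Ces_eq (S (\<lambda>n. c * a n + b n)) (\<lambda>t. c * S a t + S b t)"
    if "mem ces_gauge a" "mem ces_gauge b" for a b c
    using eqv_CesD[OF blin_combination[OF S that, of c]] by (simp add: plus_fun_def scaleR_fun_def)
  show ?thesis
  proof (intro exI conjI ballI allI)
    show "ces_norm (T f) \<le> K * Ces_norm f" if "f \<in> Ces_inf" for f
      using that by (intro ces_norm_le K Ces_gauge_norm) (simp add: Ces_inf_iff_mem)
    show "Ces_norm (S a) \<le> L * ces_norm a" if "a \<in> ces_inf" for a
      using that by (intro Ces_norm_le L ces_gauge_norm) (simp add: ces_inf_iff_mem)
  qed (simp_all add: Ces_inf_iff_mem ces_inf_iff_mem blin_mem[OF T] blin_mem[OF S] linT linS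
      eqv_CesD[OF ST] TS[unfolded eqv_ces_iff])
qed

end
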